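(* Let $(X,\trianglelefteq)$ be a parallel ordered locale satisfying (C-$\vee$). Then for all $U,W,A,B\in\mathcal{O}X$: (a) $U\in\mathrm{Cov}^{\pm}_{\trianglelefteq}(U)$; (b) $\Downarrow U\in\mathrm{Cov}^-_{\trianglelefteq}(U)$ and $\Uparrow U\in\mathrm{Cov}^+_{\trianglelefteq}(U)$; (c) if $B\in\mathrm{Cov}^{\pm}_{\trianglelefteq}(A)$ and $A\in\mathrm{Cov}^{\pm}_{\trianglelefteq}(U)$, then $B\in\mathrm{Cov}^{\pm}_{\trianglelefteq}(U)$ (same sign throughout); (d$^-$) if $A\in\mathrm{Cov}^-_{\trianglelefteq}(U)$ and $W\sqsubseteq U$, then $A\wedge\Downarrow W\in\mathrm{Cov}^-_{\trianglelefteq}(W)$; (d$^+$) if $B\in\mathrm{Cov}^+_{\trianglelefteq}(U)$ and $W\sqsubseteq U$, then $B\wedge\Uparrow W\in\mathrm{Cov}^+_{\trianglelefteq}(W)$; (e) if $A\in\mathrm{Cov}^-_{\trianglelefteq}(U)$ then $A\trianglelefteq U$, and if $B\in\mathrm{Cov}^+_{\trianglelefteq}(U)$ then $U\trianglelefteq B$; (f) $\mathrm{Cov}^{\pm}_{\trianglelefteq}(\varnothing)=\{\varnothing\}$.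
   Context: A locale $X$ is given by a frame $\mathcal{O}X$ (order $\sqsubseteq$, bottom $\varnothing$). An ordered locale $(X,\trianglelefteq)$ is a locale with a preorder $\trianglelefteq$ on $\mathcal{O}X$ such that $U_i\trianglelefteq V_i$ for all $i\in I$ implies $\bigvee_iU_i\trianglelefteq\bigvee_iV_i$. Cones: $\Uparrow U=\bigvee\{V:U\trianglelefteq V\}$, $\Downarrow U=\bigvee\{W:W\trianglelefteq U\}$. (C-$\vee$): $\Uparrow,\Downarrow$ preserve arbitrary joins. Parallel ordered: (i) $U\sqsubseteq V\trianglelefteq V'$ implies there is $U'$ with $U\trianglelefteq U'\sqsubseteq V'$; (ii) $V\trianglelefteq V'$ and $U'\sqsubseteq V'$ imply there is $U\sqsubseteq V$ with $U\trianglelefteq U'$; (iii) $U\trianglelefteq\varnothing$ or $\varnothing\trianglelefteq U$ implies $U=\varnothing$. A path is a finite sequence $p=(p_n)_{n=0}^N$ of nonempty ($\neq\varnothing$) elements of $\mathcal{O}X$ with $p_n\trianglelefteq p_{n+1}$; $p_\top=p_N$ is its endpoint and $p_\bot=p_0$ its starting point. It lands in $U$ if $p_\top\sqsubseteq U$, and inhabits $A$ if $p_n\sqsubseteq A$ for some $n$. A path $q$ refines $p$, written $q\Subset p$, if for every $n$ there is $m$ with $q_m\sqsubseteq p_n$. For nonempty $W\sqsubseteq p_\top$ the restriction $p|_W$ is the path with $(p|_W)_N=W$ and $(p|_W)_n=p_n\wedge\Downarrow(p|_W)_{n+1}$; for nonempty $V\sqsubseteq p_\bot$, $p|^V$ is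 the path with $(p|^V)_0=V$ and $(p|^V)_{n+1}=p_{n+1}\wedge\Uparrow(p|^V)_n$. A local past refinement of $p$ is a family of paths $(q^j)_{j\in J}$ with $\bigvee_jq^j_\top=p_\top$ and $q^j\Subset p|_{q^j_\top}$ for all $j$; a local future refinement is a family with $\bigvee_jq^j_\bot=p_\bot$ and $q^j\Subset p|^{q^j_\bot}$ for all $j$. $A\in\mathrm{Cov}^-_{\trianglelefteq}(U)$ iff $A\sqsubseteq\Downarrow U$ and every path landing in $U$ has a local past refinement $(q^j)_j$ such that each $q^j$ inhabits $A$. Dually, $B\in\mathrm{Cov}^+_{\trianglelefteq}(U)$ iff $B\sqsubseteq\Uparrow U$ and every path $p$ with $p_\bot\sqsubseteq U$ has a local future refinement $(q^j)_j$ such that each $q^j$ inhabits $B$. *)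

theory Defs
  imports Main
begin

class frame = complete_lattice +
  assumes inf_Sup_frame: "inf a (Sup B) = Sup ((\<lambda>b. inf a b) ` B)"

text \<open>
  A point-free locale is given by its frame of opens, here the type \<^typ>\<open>'a::frame\<close> with
  order \<open>\<le>\<close> and least element \<^term>\<open>bot\<close>; \<^term>\<open>le\<close> is the additional preorder on opens.

  In \<open>le_Sup\<close> an indexed family of pairs \<open>U\<^sub>i, V\<^sub>i\<close> with \<open>U\<^sub>i\<close> below \<open>V\<^sub>i\<close> is represented by its
  set \<open>R\<close> of pairs. The two joins depend only on this set, so no index type has to be chosen.
\<close>

locale ordered_locale =
  fixes le :: "'a::frame \<Rightarrow> 'a \<Rightarrow> bool"
  assumes le_refl: "le U U"
    and le_trans: "le U V \<Longrightarrow> le V W \<Longrightarrow> le U W"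
    and le_Sup: "(\<And>U V. (U, V) \<in> R \<Longrightarrow> le U V) \<Longrightarrow> le (Sup (fst ` R)) (Sup (snd ` R))"

locale parallel_ordered_locale = ordered_locale le
  for le :: "'a::frame \<Rightarrow> 'a \<Rightarrow> bool" +
  assumes parallel_future: "U \<le> V \<Longrightarrow> le V V' \<Longrightarrow> \<exists>U'. le U U' \<and> U' \<le> V'"
    and parallel_past: "le V V' \<Longrightarrow> U' \<le> V' \<Longrightarrow> \<exists>U. U \<le> V \<and> le U U'"
    and parallel_bot: "le U bot \<or> le bot U \<Longrightarrow> U = bot"

definition up_cone :: "('a::frame \<Rightarrow> 'a \<Rightarrow> bool) \<Rightarrow> 'a \<Rightarrow> 'a" where
  "up_cone le U = Sup {V. le U V}"

definition down_cone :: "('a::frame \<Rightarrow> 'a \<Rightarrow> bool) \<Rightarrow> 'a \<Rightarrow> 'a" where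
  "down_cone le U = Sup {W. le W U}"

definition cones_preserve_joins :: "('a::frame \<Rightarrow> 'a \<Rightarrow> bool) \<Rightarrow> bool" where
  "cones_preserve_joins le \<longleftrightarrow>
     (\<forall>S. up_cone le (Sup S) = Sup (up_cone le ` S)) \<and>
     (\<forall>S. down_cone le (Sup S) = Sup (down_cone le ` S))"

text \<open>
  A path \<open>p\<^sub>0, \<dots>, p\<^sub>N\<close> is the nonempty list of its \<open>N + 1\<close> members; its starting point
  is \<^term>\<open>hd p\<close> and its endpoint is \<^term>\<open>last p\<close>.
\<close>

definition is_path :: "('a::frame \<Rightarrow> 'a \<Rightarrow> bool) \<Rightarrow> 'a list \<Rightarrow> bool" where
  "is_path le p \<longleftrightarrow> p \<noteq> [] \<and> (\<forall>n < length p. p ! n \<noteq> bot) \<and>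
     (\<forall>n. Suc n < length p \<longrightarrow> le (p ! n) (p ! Suc n))"

definition lands :: "'a::frame list \<Rightarrow> 'a \<Rightarrow> bool" where
  "lands p U \<longleftrightarrow> last p \<le> U"

definition inhabits :: "'a::frame list \<Rightarrow> 'a \<Rightarrow> bool" where
  "inhabits p A \<longleftrightarrow> (\<exists>n < length p. p ! n \<le> A)"

definition refines :: "'a::frame list \<Rightarrow> 'a list \<Rightarrow> bool" where
  "refines q p \<longleftrightarrow> (\<forall>n < length p. \<exists>m < length q. q ! m \<le> p ! n)"

text \<open>
  \<open>restrict_end le p W\<close> replaces the endpoint of \<open>p\<close> by \<open>W\<close> and works backwards;
  \<open>restrict_start le p V\<close> replaces the starting point by \<open>V\<close> and works forwards. They are
  meant for paths \<open>p\<close> and nonempty opens \<open>W\<close> below the endpoint, respectively \<open>V\<close> below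
  the starting point.
\<close>

fun restrict_end :: "('a::frame \<Rightarrow> 'a \<Rightarrow> bool) \<Rightarrow> 'a list \<Rightarrow> 'a \<Rightarrow> 'a list" where
  "restrict_end le [] W = []"
| "restrict_end le [x] W = [W]"
| "restrict_end le (x # y # ys) W =
     (let r = restrict_end le (y # ys) W in inf x (down_cone le (hd r)) # r)"

fun restrict_start :: "('a::frame \<Rightarrow> 'a \<Rightarrow> bool) \<Rightarrow> 'a list \<Rightarrow> 'a \<Rightarrow> 'a list" where
  "restrict_start le [] V = []"
| "restrict_start le [x] V = [V]"
| "restrict_start le (x # y # ys) V =
     V # restrict_start le (y # ys) (inf y (up_cone le V))"

lemma length_restrict_end [simp]: "length (restrict_end le p W) = length p"
  by (induction le p W rule: restrict_end.induct) (auto simp: Let_def)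

lemma last_restrict_end: "p \<noteq> [] \<Longrightarrow> last (restrict_end le p W) = W"
proof (induction le p W rule: restrict_end.induct)
  case (3 le x y ys W)
  have "restrict_end le (y # ys) W \<noteq> []"
    using length_restrict_end[of le "y # ys" W] by fastforce
  with 3 show ?case by (simp add: Let_def)
qed auto

lemma restrict_end_nth:
  "Suc n < length p \<Longrightarrow>
     restrict_end le p W ! n = inf (p ! n) (down_cone le (restrict_end le p W ! Suc n))"
proof (induction le p W arbitrary: n rule: restrict_end.induct)
  case (3 le x y ys W)
  have "restrict_end le (y # ys) W \<noteq> []"
    using length_restrict_end[of le "y # ys" W] by fastforce
  with 3 show ?case by (cases n) (simp_all add: Let_def hd_conv_nth)
qed auto

lemma length_restrict_start [simp]: "length (restrict_start le p V) = length p"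
  by (induction le p V rule: restrict_start.induct) auto

lemma hd_restrict_start: "p \<noteq> [] \<Longrightarrow> hd (restrict_start le p V) = V"
  by (cases "(le, p, V)" rule: restrict_start.cases) auto

lemma restrict_start_nth:
  "Suc n < length p \<Longrightarrow>
     restrict_start le p V ! Suc n = inf (p ! Suc n) (up_cone le (restrict_start le p V ! n))"
proof (induction le p V arbitrary: n rule: restrict_start.induct)
  case (3 le x y ys V)
  let ?r = "restrict_start le (y # ys) (inf y (up_cone le V))"
  have "?r \<noteq> []"
    using length_restrict_start[of le "y # ys" "inf y (up_cone le V)"] by fastforce
  then have "?r ! 0 = inf y (up_cone le V)"
    using hd_restrict_start[of "y # ys" le "inf y (up_cone le V)"] by (simp add: hd_conv_nth)
  with 3 show ?case by (cases n) simp_all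
qed auto

text \<open>
  The conditions on a refining family concern each member separately and the join of the
  endpoints (starting points), so a family of paths is represented by the set \<open>Q\<close> of its members.
  The join condition puts every \<^term>\<open>last q\<close> below \<^term>\<open>last p\<close> (every \<^term>\<open>hd q\<close> below
  \<^term>\<open>hd p\<close>), so the restrictions below are taken at admissible opens only.
\<close>

definition local_past_refinement ::
  "('a::frame \<Rightarrow> 'a \<Rightarrow> bool) \<Rightarrow> 'a list set \<Rightarrow> 'a list \<Rightarrow> bool" where
  "local_past_refinement le Q p \<longleftrightarrow>
     (\<forall>q\<in>Q. is_path le q) \<and> Sup (last ` Q) = last p \<and>
     (\<forall>q\<in>Q. refines q (restrict_end le p (last q)))"

definition local_future_refinement ::
  "('a::frame \<Rightarrow> 'a \<Rightarrow> bool) \<Rightarrow> 'a list set \<Rightarrow> 'a list \<Rightarrow> bool" where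
  "local_future_refinement le Q p \<longleftrightarrow>
     (\<forall>q\<in>Q. is_path le q) \<and> Sup (hd ` Q) = hd p \<and>
     (\<forall>q\<in>Q. refines q (restrict_start le p (hd q)))"

definition Cov_past :: "('a::frame \<Rightarrow> 'a \<Rightarrow> bool) \<Rightarrow> 'a \<Rightarrow> 'a set" where
  "Cov_past le U = {A. A \<le> down_cone le U \<and>
     (\<forall>p. is_path le p \<and> lands p U \<longrightarrow>
        (\<exists>Q. local_past_refinement le Q p \<and> (\<forall>q\<in>Q. inhabits q A)))}"

definition Cov_future :: "('a::frame \<Rightarrow> 'a \<Rightarrow> bool) \<Rightarrow> 'a \<Rightarrow> 'a set" where
  "Cov_future le U = {B. B \<le> up_cone le U \<and>
     (\<forall>p. is_path le p \<and> hd p \<le> U \<longrightarrow>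
        (\<exists>Q. local_future_refinement le Q p \<and> (\<forall>q\<in>Q. inhabits q B)))}"

end

theory Submission
  imports Defs "HOL-Library.Sublist"
begin

text \<open>
  The only hard part is transitivity. A path \<open>p\<close> into \<open>U\<close> is refined by paths \<open>q\<close> through \<open>A\<close>, and
  refining \<open>q\<close> up to \<open>A\<close> by paths through \<open>B\<close> means replacing the member of \<open>q\<close> in \<open>A\<close> by
  smaller opens and restricting the rest of \<open>q\<close> accordingly. Since \<open>q\<close> may visit the members of
  \<open>p\<close> in any order, the restriction of \<open>q\<close> need not refine the restriction of \<open>p\<close>: from the
  visit of \<open>p\<^sub>i\<close> one can go on to \<open>p\<^sub>i\<^sub>+\<^sub>1, p\<^sub>i\<^sub>+\<^sub>2, \<dots>\<close>, but perhaps only into a part of \<open>p\<^sub>N\<close> that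
  the rest of \<open>q\<close> does not reach. This is harmless if from there one can follow an itinerary which
  contains the order in which \<open>q\<close> proceeds.

  Otherwise \<open>q\<close> visits some \<open>p\<^sub>j\<close> before a \<open>p\<^sub>c\<close> with \<open>c < j\<close>. The path which follows \<open>p\<close> up to
  that visit of \<open>p\<^sub>j\<close> and \<open>q\<close> afterwards then admits, at each \<open>p\<^sub>i\<close> with \<open>i \<le> j\<close>, the itinerary
  \<open>i + 1, \<dots>, j, c\<close> followed by one available at \<open>p\<^sub>c\<close>. Applying the hypothesis on \<open>A\<close> to this path
  and repeating, the itineraries become so rich after boundedly many steps that the good case
  must occur. The statements about the future follow by reversing the order.
\<close>

lemma subseq_upt: "a \<le> b \<Longrightarrow> subseq [b..<n] [a..<n]"
proof (cases "b \<le> n")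
  case True
  assume "a \<le> b"
  then have "[a..<n] = [a..<b] @ [b..<n]" using True by (metis le_Suc_ex upt_add_eq_append)
  then show ?thesis by (simp add: list_emb_append2)
qed simp

subsection \<open>Words of stops\<close>

text \<open>Words list stops of a path whose endpoint has index \<open>N\<close>. The condition is
  what lets a word pass through \<open>legs\<close>: a stop \<open>a\<close> with only larger ones
  after it demands an itinerary containing \<open>[Suc a..<N]\<close>.\<close>

primrec followed :: "nat \<Rightarrow> nat list \<Rightarrow> bool" where
  "followed N [] \<longleftrightarrow> True"
| "followed N (a # w) \<longleftrightarrow> subseq [Suc a..<N] w \<and> followed N w"

text \<open>\<open>W k\<close> is the itinerary available at stop \<open>k\<close>. Nesting makes it
  usable at every earlier stop, after walking along the path up to \<open>k\<close>.\<close>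

definition nested :: "nat \<Rightarrow> (nat \<Rightarrow> nat list) \<Rightarrow> bool" where
  "nested N W \<longleftrightarrow> (\<forall>i k. i \<le> k \<longrightarrow> k < N \<longrightarrow> subseq ([Suc i..<Suc k] @ W k) (W i)) \<and>
     (\<forall>i < N. followed N (W i))"

text \<open>The itineraries of a path that keeps to the given one up to stop \<open>j\<close> and
  can go back to \<open>x\<close> from there: up to \<open>j\<close> one goes on to
  \<open>j\<close>, then to \<open>x\<close>, then as from \<open>x\<close>.\<close>

definition graft :: "(nat \<Rightarrow> nat list) \<Rightarrow> nat \<Rightarrow> nat \<Rightarrow> nat \<Rightarrow> nat list" where
  "graft W j x = (\<lambda>k. if k \<le> j then [Suc k..<Suc j] @ x # W x else W k)"

text \<open>
  \<open>potential\<close> reads the numbers of words available at the stops as the digits of a number, since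
  \<open>graft W j x\<close> may destroy words at the stops below \<open>x\<close> but not at those above.
\<close>

definition words :: "nat \<Rightarrow> nat list \<Rightarrow> nat list set" where
  "words N l = {w. distinct w \<and> set w \<subseteq> {..<N} \<and> subseq w l}"

definition potential :: "nat \<Rightarrow> (nat \<Rightarrow> nat list) \<Rightarrow> nat" where
  "potential N W =
     (\<Sum>i<N. card (words N (W i)) * Suc (card {w. distinct w \<and> set w \<subseteq> {..<N}}) ^ i)"

lemma nested_append: "nested N W \<Longrightarrow> i \<le> k \<Longrightarrow> k < N \<Longrightarrow> subseq ([Suc i..<Suc k] @ W k) (W i)"
  by (simp add: nested_def)

lemma nested_followed: "nested N W \<Longrightarrow> i < N \<Longrightarrow> followed N (W i)"
  by (simp add: nested_def)

lemma nested_subseq: "nested N W \<Longrightarrow> i \<le> k \<Longrightarrow> k < N \<Longrightarrow> subseq (W k) (W i)"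
  using nested_append subseq_order.trans list_emb_append2 subseq_order.order_refl by metis

lemma nested_upt: "nested N W \<Longrightarrow> i < N \<Longrightarrow> subseq [Suc i..<N] (W i)"
proof -
  assume *: "nested N W" "i < N"
  then have "subseq ([Suc i..<N] @ W (N - 1)) (W i)"
    using nested_append[of N W i "N - 1"] by simp
  then show ?thesis using subseq_order.trans list_emb_prefix subseq_order.order_refl by metis
qed

lemma followed_upt_append:
  "followed N y \<Longrightarrow> subseq [b..<N] y \<Longrightarrow> b \<le> N \<Longrightarrow> followed N ([a..<b] @ y)"
proof (induction "b - a" arbitrary: a)
  case (Suc n)
  then have a: "[a..<b] = a # [Suc a..<b]" by (simp add: upt_conv_Cons)
  have "[Suc a..<N] = [Suc a..<b] @ [b..<N]"
    using Suc by (metis Suc_leI le_add_diff_inverse upt_add_eq_append zero_less_Suc zero_less_diff)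
  then have "subseq [Suc a..<N] ([Suc a..<b] @ y)"
    using Suc.prems by (metis list_emb_append_mono subseq_order.order_refl)
  then show ?case using Suc a by simp
qed simp

lemma nested_upto: "nested N (\<lambda>i. [Suc i..<N])"
proof -
  have "followed N [a..<N]" for a using followed_upt_append[of N "[]" N a] by simp
  moreover have "[Suc i..<Suc k] @ [Suc k..<N] = [Suc i..<N]" if "i \<le> k" "k < N" for i k
    using that by (metis Suc_leI Suc_le_mono le_add_diff_inverse upt_add_eq_append)
  ultimately show ?thesis by (simp add: nested_def del: upt_Suc)
qed

text \<open>The delicate case is \<open>i \<le> j < k\<close>. Nestedness at \<open>x\<close> puts
  \<open>[Suc x..<Suc k] @ W k\<close> into \<open>W x\<close>; since \<open>x < j\<close>, this
  contains what must follow once \<open>j\<close> has been reached.\<close>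

lemma nested_graft:
  assumes W: "nested N W" and x: "x < j" "j < N"
  shows "nested N (graft W j x)"
proof -
  have tail: "subseq [Suc j..<N] (W x)"
    using nested_upt[OF W, of x] subseq_upt[of "Suc x" "Suc j" N] x subseq_order.trans by fastforce
  have "followed N (graft W j x i)" if "i < N" for i
    using that followed_upt_append[of N "x # W x" "Suc j" "Suc i"] tail nested_upt[OF W, of x]
      nested_followed[OF W] x by (simp add: graft_def list_emb_Cons del: upt_Suc)
  moreover have "subseq ([Suc i..<Suc k] @ graft W j x k) (graft W j x i)"
    if ik: "i \<le> k" "k < N" for i k
  proof -
    consider "k \<le> j" | "i \<le> j" "j < k" | "j < i" using ik by linarith
    then show ?thesis
    proof cases
      case 1
      then have "[Suc i..<Suc j] = [Suc i..<Suc k] @ [Suc k..<Suc j]"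
        using ik by (metis Suc_le_mono le_add_diff_inverse upt_add_eq_append)
      then show ?thesis using 1 ik by (simp add: graft_def del: upt_Suc)
    next
      case 2
      have "[Suc x..<Suc k] = [Suc x..<Suc j] @ [Suc j..<Suc k]"
        using x 2 by (metis Suc_le_mono le_add_diff_inverse less_imp_le upt_add_eq_append)
      then have "subseq ([Suc x..<Suc j] @ [Suc j..<Suc k] @ W k) (W x)"
        using nested_append[OF W, of x k] x 2 ik by (simp del: upt_Suc)
      then have "subseq ([Suc j..<Suc k] @ W k) (x # W x)"
        using subseq_order.trans list_emb_append2 list_emb_Cons subseq_order.order_refl by metis
      moreover have "[Suc i..<Suc k] = [Suc i..<Suc j] @ [Suc j..<Suc k]"
        using 2 by (metis Suc_le_mono le_add_diff_inverse less_imp_le upt_add_eq_append)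
      ultimately show ?thesis
        using 2 by (simp add: graft_def list_emb_append_mono del: upt_Suc)
    next
      case 3
      then show ?thesis using nested_append[OF W] ik by (simp add: graft_def del: upt_Suc)
    qed
  qed
  ultimately show ?thesis by (simp add: nested_def)
qed

section \<open>Counting words, and growth of the potential\<close>

lemma finite_distinct_lists: "finite A \<Longrightarrow> finite {w. distinct w \<and> set w \<subseteq> A}"
  by (rule finite_subset[OF _ finite_lists_length_le[of A "card A"]])
    (auto simp: distinct_card[symmetric] card_mono)

lemma words_subset: "words N l \<subseteq> {w. distinct w \<and> set w \<subseteq> {..<N}}"
  by (auto simp: words_def)

lemma finite_words: "finite (words N l)"
  using finite_subset[OF words_subset finite_distinct_lists] by blast

lemma card_words_le: "card (words N l) \<le> card {w. distinct w \<and> set w \<subseteq> {..<N}}"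
  by (intro card_mono words_subset finite_distinct_lists) simp

definition potential_bound :: "nat \<Rightarrow> nat" where
  "potential_bound N = (\<Sum>i<N. card {w. distinct w \<and> set w \<subseteq> {..<N}} *
     Suc (card {w. distinct w \<and> set w \<subseteq> {..<N}}) ^ i)"

lemma potential_le: "potential N W \<le> potential_bound N"
  unfolding potential_def potential_bound_def by (intro sum_mono mult_right_mono card_words_le) simp

lemma digit_sum_less:
  fixes f :: "nat \<Rightarrow> nat"
  shows "(\<And>i. i < x \<Longrightarrow> f i \<le> c) \<Longrightarrow> (\<Sum>i<x. f i * Suc c ^ i) < Suc c ^ x"
proof (induction x)
  case (Suc x)
  then have "(\<Sum>i<x. f i * Suc c ^ i) < Suc c ^ x" "f x * Suc c ^ x \<le> c * Suc c ^ x"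
    by (simp, intro mult_right_mono) simp_all
  then have "(\<Sum>i<x. f i * Suc c ^ i) + f x * Suc c ^ x < Suc c ^ x + c * Suc c ^ x"
    by (rule add_less_le_mono)
  then show ?case by simp
qed simp

text \<open>All digits below place \<open>x\<close> together are worth less than one unit at
  \<open>x\<close>, so losses there cannot undo the gain at \<open>x\<close>.\<close>

lemma digit_sum_strict_mono:
  fixes f g :: "nat \<Rightarrow> nat"
  assumes "x < N" "f x < g x" "\<And>k. x < k \<Longrightarrow> k < N \<Longrightarrow> f k \<le> g k" "\<And>i. f i \<le> c"
  shows "(\<Sum>i<N. f i * Suc c ^ i) < (\<Sum>i<N. g i * Suc c ^ i)"
proof -
  have split: "(\<Sum>i<N. h i) = (\<Sum>i<x. h i) + h x + (\<Sum>i=Suc x..<N. h i)" for h :: "nat \<Rightarrow> nat"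
    using assms(1) sum.atLeastLessThan_concat[of 0 x N h] sum.atLeast_Suc_lessThan[of x N h]
    by (simp add: atLeast0LessThan)
  have "(\<Sum>i<x. f i * Suc c ^ i) + f x * Suc c ^ x < Suc (f x) * Suc c ^ x"
    using digit_sum_less[of x f c] assms(4) by simp
  also have "\<dots> \<le> g x * Suc c ^ x" using assms(2) by (intro mult_right_mono) simp_all
  finally have "(\<Sum>i<x. f i * Suc c ^ i) + f x * Suc c ^ x < (\<Sum>i<x. g i * Suc c ^ i) + g x * Suc c ^ x"
    by simp
  moreover have "(\<Sum>i=Suc x..<N. f i * Suc c ^ i) \<le> (\<Sum>i=Suc x..<N. g i * Suc c ^ i)"
    using assms(3) by (intro sum_mono mult_right_mono) simp_all
  ultimately show ?thesis by (simp add: split)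
qed

text \<open>No word is lost at a stop \<open>k \<ge> x\<close>: beyond \<open>j\<close> nothing
  changes, and up to \<open>j\<close> the new itinerary ends with \<open>W x\<close>, which contains
  \<open>W k\<close>. The word \<open>l\<close> is the gain at digit \<open>x\<close>.\<close>

lemma potential_graft:
  assumes W: "nested N W" and x: "x < j" "j < N"
    and new: "l \<in> words N (graft W j x x)" "l \<notin> words N (W x)"
  shows "potential N W < potential N (graft W j x)"
proof -
  have sub: "words N (W k) \<subseteq> words N (graft W j x k)" if k: "x \<le> k" "k < N" for k
  proof -
    have "subseq (W k) (graft W j x k)"
      using nested_subseq[OF W k]
      by (auto simp: graft_def simp del: upt_Suc intro!: list_emb_append2 list_emb_Cons)
    then show ?thesis by (auto simp: words_def intro: subseq_order.trans)
  qed
  have "card (words N (W x)) < card (words N (graft W j x x))"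
    using new sub[of x] x by (intro psubset_card_mono finite_words) auto
  moreover have "card (words N (W k)) \<le> card (words N (graft W j x k))" if "x < k" "k < N" for k
    using sub that by (intro card_mono finite_words) simp
  ultimately show ?thesis unfolding potential_def
    using x by (intro digit_sum_strict_mono[of x] card_words_le) simp_all
qed

text \<open>Split \<open>v = l @ c # r\<close> at its least letter. By induction \<open>r\<close>
  lies in \<open>W c\<close>. If \<open>l\<close> is empty, walking from \<open>i\<close> to
  \<open>c\<close> prepends \<open>c\<close>. Otherwise every letter of \<open>l\<close> forms an
  inversion with \<open>c\<close>, so the closure hypothesis prepends first \<open>c\<close> and
  then the letters of \<open>l\<close> from right to left, and \<open>W c\<close> lies in
  \<open>W i\<close>.\<close>

lemma subseq_nested:
  assumes W: "nested N W"
  shows "distinct v \<Longrightarrow> i < N \<Longrightarrow> set v \<subseteq> {Suc i..<N} \<Longrightarrow>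
    (\<And>b c e w. subseq [b, c] v \<Longrightarrow> c < b \<Longrightarrow> e \<in> {b, c} \<Longrightarrow> w \<in> words N (W c) \<Longrightarrow> e \<notin> set w \<Longrightarrow>
      subseq (e # w) (W c)) \<Longrightarrow> subseq v (W i)"
proof (induction "length v" arbitrary: v i rule: less_induct)
  case less
  note closed = less.prems(4)
  show ?case
  proof (cases "v = []")
    case False
    define c where "c = Min (set v)"
    have "c \<in> set v" and c_le: "\<And>b. b \<in> set v \<Longrightarrow> c \<le> b" using False by (auto simp: c_def)
    then obtain l r where v: "v = l @ c # r" by (meson split_list)
    have c: "i < c" "c < N" using less.prems \<open>c \<in> set v\<close> by auto
    have gt: "c < b" if "b \<in> set l \<union> set r" for b
      using that c_le[of b] less.prems(1) v by (cases "b = c") auto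
    have r: "set r \<subseteq> {Suc c..<N}" using gt less.prems(3) v by (auto simp: Suc_le_eq)
    have "subseq r (W c)"
    proof (rule less.hyps)
      fix b c' e w
      assume "subseq [b, c'] r" and *: "c' < b" "e \<in> {b, c'}" "w \<in> words N (W c')" "e \<notin> set w"
      then have "subseq [b, c'] v" unfolding v by (intro list_emb_append2 list_emb_Cons)
      then show "subseq (e # w) (W c')" using closed * by blast
    qed (use less.prems(1) v r c in auto)
    have *: "subseq (l' @ c # r) (W c)" if l: "l = l'' @ l'" "l \<noteq> []" for l' l''
      using l(1)
    proof (induction l' arbitrary: l'')
      case Nil
      obtain b where b: "b \<in> set l" using l(2) by (cases l) auto
      then have "subseq [b, c] v" unfolding v by (auto simp: subseq_singleton_left
        intro!: list_emb_append_mono[of _ "[b]" l "[c]", simplified])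
      moreover have "r \<in> words N (W c)"
        using \<open>subseq r (W c)\<close> less.prems v by (auto simp: words_def)
      ultimately show ?case using closed[of b c c r] gt[of b] b less.prems(1) v by simp
    next
      case (Cons b l')
      have b: "b \<in> set l" using Cons.prems by simp
      then have "subseq [b, c] v" unfolding v by (auto simp: subseq_singleton_left
        intro!: list_emb_append_mono[of _ "[b]" l "[c]", simplified])
      moreover have "l' @ c # r \<in> words N (W c)"
        using Cons.IH[of "l'' @ [b]"] Cons.prems less.prems v by (auto simp: words_def)
      ultimately show ?case
        using closed[of b c b "l' @ c # r"] gt[of b] b less.prems(1) v Cons.prems by auto
    qed
    show ?thesis
    proof (cases "l = []")
      case True
      have "[Suc i..<Suc c] = [Suc i..<c] @ [c]" using c by simp
      then have "subseq ([Suc i..<c] @ c # W c) (W i)"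
        using nested_append[OF W, of i c] c by simp
      moreover have "subseq (c # r) ([Suc i..<c] @ c # W c)"
        using \<open>subseq r (W c)\<close> by (intro list_emb_append2) simp
      ultimately show ?thesis using True v subseq_order.trans by auto
    next
      case False
      then show ?thesis
        using *[of "[]" l] v nested_subseq[OF W, of i c] c subseq_order.trans by auto
    qed
  qed simp
qed

lemma local_past_refinement_last_le:
  "local_past_refinement le Q p \<Longrightarrow> q \<in> Q \<Longrightarrow> last q \<le> last p"
  unfolding local_past_refinement_def by (metis SUP_upper)

subsection \<open>Cones and paths\<close>

locale cone_ordered_locale = parallel_ordered_locale le
  for le :: "'a::frame \<Rightarrow> 'a \<Rightarrow> bool" +
  assumes cones_Sup: "cones_preserve_joins le"
begin

abbreviation d :: "'a \<Rightarrow> 'a" where "d \<equiv> down_cone le"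
abbreviation u :: "'a \<Rightarrow> 'a" where "u \<equiv> up_cone le"

lemma d_Sup: "d (Sup S) = Sup (d ` S)"
  and u_Sup: "u (Sup S) = Sup (u ` S)"
  using cones_Sup unfolding cones_preserve_joins_def by blast+

lemma d_sup: "d (sup x y) = sup (d x) (d y)"
  and u_sup: "u (sup x y) = sup (u x) (u y)"
  using d_Sup[of "{x, y}"] u_Sup[of "{x, y}"] by simp_all

lemma d_mono: "x \<le> y \<Longrightarrow> d x \<le> d y"
  and u_mono: "x \<le> y \<Longrightarrow> u x \<le> u y"
  by (metis d_sup le_iff_sup) (metis u_sup le_iff_sup)

lemma le_d_trans: "x \<le> d y \<Longrightarrow> y \<le> z \<Longrightarrow> x \<le> d z"
  using d_mono order_trans by blast

lemma d_bot [simp]: "d bot = bot"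
  using d_Sup[of "{}"] by simp

lemma le_imp_d: "le x y \<Longrightarrow> x \<le> d y"
  and le_imp_u: "le x y \<Longrightarrow> y \<le> u x"
  unfolding down_cone_def up_cone_def by (auto intro: Sup_upper)

lemma le_d: "le (d x) x"
proof -
  have "le (Sup (fst ` {(w, x) |w. le w x})) (Sup (snd ` {(w, x) |w. le w x}))"
    by (rule le_Sup) auto
  moreover have "fst ` {(w, x) |w. le w x} = {w. le w x}" by force
  moreover have "snd ` {(w, x) |w. le w x} = {x}" using le_refl[of x] by force
  ultimately show ?thesis by (simp add: down_cone_def)
qed

lemma le_u: "le x (u x)"
proof -
  have "le (Sup (fst ` {(x, w) |w. le x w})) (Sup (snd ` {(x, w) |w. le x w}))"
    by (rule le_Sup) auto
  moreover have "snd ` {(x, w) |w. le x w} = {w. le x w}" by force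
  moreover have "fst ` {(x, w) |w. le x w} = {x}" using le_refl[of x] by force
  ultimately show ?thesis by (simp add: up_cone_def)
qed

lemma d_ge: "x \<le> d x"
  and u_ge: "x \<le> u x"
  using le_refl le_imp_d le_imp_u by blast+

lemma d_d [simp]: "d (d x) = d x"
  by (meson le_trans le_d le_imp_d d_ge antisym)

lemma u_u [simp]: "u (u x) = u x"
  by (meson le_trans le_u le_imp_u u_ge antisym)

text \<open>The part of \<open>x\<close> below \<open>d y\<close> can be moved into \<open>y\<close>
  by \<open>parallel_future\<close>, and the place where it arrives lies in the future of
  \<open>x\<close> as well.\<close>

lemma d_frobenius: "inf x (d y) \<le> d (inf y (u x))"
proof -
  obtain z where z: "le (inf x (d y)) z" "z \<le> y"
    using parallel_future[OF inf_le2 le_d] by blast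
  have "z \<le> u x" using le_imp_u[OF z(1)] u_mono[OF inf_le1] by (rule order_trans)
  then have "z \<le> inf y (u x)" using z by simp
  then show ?thesis using le_imp_d[OF z(1)] d_mono order_trans by blast
qed

lemma u_frobenius: "inf y (u x) \<le> u (inf x (d y))"
proof -
  obtain z where z: "z \<le> x" "le z (inf y (u x))"
    using parallel_past[OF le_u inf_le2] by blast
  have "z \<le> d y" using le_imp_d[OF z(2)] d_mono[OF inf_le1] by (rule order_trans)
  then have "z \<le> inf x (d y)" using z by simp
  then show ?thesis using le_imp_u[OF z(2)] u_mono order_trans by blast
qed

text \<open>For the converse, parallelness relates \<open>x\<close> to some
  \<open>y' \<le> y\<close> and some \<open>x' \<le> x\<close> to \<open>y\<close>; joining the two
  pairs relates \<open>x\<close> to \<open>y\<close>. So paths can be built by calculating with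
  cones and meets.\<close>

lemma le_iff: "le x y \<longleftrightarrow> x \<le> d y \<and> y \<le> u x"
proof
  assume *: "x \<le> d y \<and> y \<le> u x"
  obtain y' where y': "le x y'" "y' \<le> y"
    using parallel_future[OF _ le_d] * by blast
  obtain x' where x': "x' \<le> x" "le x' y"
    using parallel_past[OF le_u] * by blast
  have "le (Sup (fst ` {(x, y'), (x', y)})) (Sup (snd ` {(x, y'), (x', y)}))"
    by (rule le_Sup) (use x' y' in auto)
  then show "le x y" using x' y' by (simp add: sup_absorb1 sup_absorb2)
qed (auto intro: le_imp_d le_imp_u)

lemma le_inf_u: "x \<le> d y \<Longrightarrow> le x (inf (u x) y)"
  using d_frobenius[of x y] by (simp add: le_iff inf.absorb1 inf_commute)

lemma le_inf_d: "y \<le> u x \<Longrightarrow> le (inf x (d y)) y"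
  using u_frobenius[of y x] by (simp add: le_iff inf.absorb1)

lemma Sup_inf: "inf (Sup S) (a::'a) = Sup ((\<lambda>s. inf s a) ` S)"
  using inf_Sup_frame[of a S] by (simp add: inf_commute)

section \<open>Paths and their restrictions\<close>

lemma transp_le: "transp le"
  using le_trans by (auto intro: transpI)

lemma is_path_iff: "is_path le p \<longleftrightarrow> p \<noteq> [] \<and> bot \<notin> set p \<and> sorted_wrt le p"
proof -
  have "sorted_wrt le p \<longleftrightarrow> (\<forall>n. Suc n < length p \<longrightarrow> le (p ! n) (p ! Suc n))"
    using sorted_wrt_iff_nth_Suc_transp[OF transp_le] by blast
  then show ?thesis by (auto simp: is_path_def in_set_conv_nth)
qed

lemma path_nth_le: "is_path le p \<Longrightarrow> i \<le> j \<Longrightarrow> j < length p \<Longrightarrow> le (p ! i) (p ! j)"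
  by (cases "i = j") (auto simp: is_path_iff le_refl sorted_wrt_iff_nth_less)

lemma path_le_last: "is_path le p \<Longrightarrow> x \<in> set p \<Longrightarrow> le x (last p)"
  by (auto simp: in_set_conv_nth last_conv_nth is_path_iff intro!: path_nth_le)

lemma path_hd_le: "is_path le p \<Longrightarrow> x \<in> set p \<Longrightarrow> le (hd p) x"
  by (auto simp: in_set_conv_nth hd_conv_nth is_path_iff intro!: path_nth_le)

lemma path_append:
  assumes "is_path le p" "is_path le q" "le (last p) (hd q)"
  shows "is_path le (p @ q)"
  using assms path_le_last[OF assms(1)] path_hd_le[OF assms(2)] le_trans
  by (auto simp: is_path_iff sorted_wrt_append) blast

lemma path_drop: "is_path le p \<Longrightarrow> n < length p \<Longrightarrow> is_path le (drop n p)"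
  by (auto simp: is_path_iff sorted_wrt_drop dest: in_set_dropD)

lemma path_take: "is_path le p \<Longrightarrow> 0 < n \<Longrightarrow> is_path le (take n p)"
  by (auto simp: is_path_iff sorted_wrt_take dest: in_set_takeD)

lemma restrict_end_last: "Suc n = length p \<Longrightarrow> restrict_end le p W ! n = W"
  using last_restrict_end[of p le W] last_conv_nth[of "restrict_end le p W"]
  by (metis Zero_not_Suc diff_Suc_1 length_restrict_end list.size(3))

lemma restrict_end_le:
  assumes "W \<le> last p" "n < length p"
  shows "restrict_end le p W ! n \<le> p ! n"
proof (cases "Suc n = length p")
  case True
  then have "p ! n = last p"
    by (metis Zero_not_Suc diff_Suc_1 last_conv_nth list.size(3))
  then show ?thesis using assms True by (simp add: restrict_end_last)
qed (use assms in \<open>simp add: restrict_end_nth\<close>)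

lemma restrict_end_path:
  assumes p: "is_path le p" and W: "W \<le> last p" "W \<noteq> bot"
  shows "is_path le (restrict_end le p W)"
proof -
  let ?r = "restrict_end le p W"
  have step: "le (?r ! n) (?r ! Suc n)" if n: "Suc n < length p" for n
  proof -
    have "?r ! Suc n \<le> p ! Suc n" using n W by (intro restrict_end_le)
    also have "\<dots> \<le> u (p ! n)" using path_nth_le[OF p, of n "Suc n"] n by (simp add: le_imp_u)
    finally show ?thesis using n by (simp add: restrict_end_nth le_inf_d)
  qed
  have ne: "?r ! n \<noteq> bot" if "n < length p" for n
    using that
  proof (induction "length p - Suc n" arbitrary: n)
    case 0
    then have "Suc n = length p" by simp
    then show ?case using W by (simp add: restrict_end_last)
  next
    case (Suc k)
    then have n: "Suc n < length p" by simp
    then have "?r ! Suc n \<noteq> bot" using Suc by simp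
    then show ?case using parallel_bot step[OF n] by metis
  qed
  show ?thesis using step ne p unfolding is_path_def by (auto simp flip: length_greater_0_conv)
qed

subsection \<open>Prescribed itineraries\<close>

text \<open>
  \<open>itin p w z\<close> collects the opens from which one can travel into \<open>z\<close> through the members
  of \<open>p\<close> with the indices listed in \<open>w\<close>, in this order.
\<close>

primrec itin :: "'a list \<Rightarrow> nat list \<Rightarrow> 'a \<Rightarrow> 'a" where
  "itin p [] z = d z"
| "itin p (a # w) z = d (inf (p ! a) (itin p w z))"

lemma d_itin [simp]: "d (itin p w z) = itin p w z"
  by (cases w) simp_all

lemma itin_mono: "z \<le> z' \<Longrightarrow> itin p w z \<le> itin p w z'"
proof (induction w)
  case (Cons a w)
  then have "itin p w z \<le> itin p w z'" by simp
  then show ?case unfolding itin.simps by (intro d_mono inf_mono order_refl)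
qed (simp add: d_mono)

lemma itin_Cons_le: "itin p (a # w) z \<le> itin p w z"
  by (metis d_itin d_mono inf_le2 itin.simps(2))

lemma itin_subseq: "subseq w' w \<Longrightarrow> itin p w z \<le> itin p w' z"
proof (induction rule: list_emb.induct)
  case (list_emb_Nil ys)
  show ?case by (induction ys) (auto intro: order_trans[OF itin_Cons_le] simp del: itin.simps(2))
next
  case (list_emb_Cons xs ys y)
  then show ?case using itin_Cons_le order_trans by blast
next
  case (list_emb_Cons2 x y xs ys)
  then have "itin p ys z \<le> itin p xs z" by simp
  then show ?case unfolding itin.simps \<open>x = y\<close> by (intro d_mono inf_mono order_refl)
qed

lemma le_d_itin: "x \<le> d y \<Longrightarrow> y \<le> itin p w z \<Longrightarrow> x \<le> itin p w z"
  using d_mono[of y "itin p w z"] by simp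

text \<open>The stops end before \<open>length p - 1\<close> because the endpoint of
  \<open>p\<close> has been replaced by \<open>z\<close>.\<close>

lemma restrict_end_itin:
  "Suc i < length p \<Longrightarrow>
    restrict_end le p z ! i = inf (p ! i) (itin p [Suc i..<length p - 1] z)"
proof (induction "length p - i" arbitrary: i)
  case (Suc k)
  show ?case
  proof (cases "Suc (Suc i) = length p")
    case True
    then have "restrict_end le p z ! Suc i = z" by (simp add: restrict_end_last)
    moreover have "[Suc i..<length p - 1] = []" using True by simp
    ultimately show ?thesis using Suc.prems by (simp add: restrict_end_nth)
  next
    case False
    then have *: "Suc (Suc i) < length p" using Suc.prems by simp
    then have "restrict_end le p z ! Suc i = inf (p ! Suc i) (itin p [Suc (Suc i)..<length p - 1] z)"
      using Suc by simp
    moreover have "[Suc i..<length p - 1] = Suc i # [Suc (Suc i)..<length p - 1]"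
      using * by (simp add: upt_conv_Cons)
    ultimately show ?thesis using Suc.prems by (simp add: restrict_end_nth)
  qed
qed simp

lemma restrict_end_last_self:
  assumes p: "is_path le p"
  shows "restrict_end le p (last p) = p"
proof (rule nth_equalityI)
  fix i assume "i < length (restrict_end le p (last p))"
  then have "i < length p" by simp
  then show "restrict_end le p (last p) ! i = p ! i"
  proof (induction "length p - i" arbitrary: i)
    case (Suc k)
    show ?case
    proof (cases "Suc i = length p")
      case True
      then show ?thesis
        by (metis diff_Suc_1 last_conv_nth list.size(3) nat.simps(3) restrict_end_last)
    next
      case False
      then have i: "Suc i < length p" using Suc.prems by simp
      then have "p ! i \<le> d (p ! Suc i)" using path_nth_le[OF p, of i "Suc i"] by (simp add: le_imp_d)
      then show ?thesis using Suc i by (simp add: restrict_end_nth inf.absorb1)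
    qed
  qed simp
qed simp

text \<open>The condition at the endpoint of \<open>p\<close> is met by the endpoint of
  \<open>q\<close> itself, so only the earlier stops have to be checked.\<close>

lemma refines_itin_iff:
  assumes "q \<noteq> []" "p \<noteq> []"
  shows "refines q (restrict_end le p (last q)) \<longleftrightarrow>
    (\<forall>i < length p - 1. \<exists>m < length q. q ! m \<le> inf (p ! i) (itin p [Suc i..<length p - 1] (last q)))"
    (is "?l \<longleftrightarrow> ?r")
proof
  assume l: ?l
  show ?r
  proof (intro allI impI)
    fix i assume i: "i < length p - 1"
    then obtain m where "m < length q" "q ! m \<le> restrict_end le p (last q) ! i"
      using l unfolding refines_def length_restrict_end by (meson diff_le_self less_le_trans)
    then show "\<exists>m < length q. q ! m \<le> inf (p ! i) (itin p [Suc i..<length p - 1] (last q))"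
      using i restrict_end_itin[of i p "last q"] by auto
  qed
next
  assume ?r
  show ?l unfolding refines_def
  proof (intro allI impI)
    fix n assume n: "n < length (restrict_end le p (last q))"
    show "\<exists>m<length q. q ! m \<le> restrict_end le p (last q) ! n"
    proof (cases "Suc n = length p")
      case True
      then show ?thesis using assms
        by (intro exI[of _ "length q - 1"]) (simp add: restrict_end_last last_conv_nth)
    next
      case False
      then have "Suc n < length p" using n by simp
      then show ?thesis using \<open>?r\<close> restrict_end_itin[of n p "last q"] by auto
    qed
  qed
qed


text \<open>
  \<open>hit p w Xs\<close>: travel along \<open>w\<close> into \<open>last p\<close> while passing through the members of \<open>Xs\<close>
  in their order, each of them at one of the stops of \<open>w\<close>.
\<close>

fun hit :: "'a list \<Rightarrow> nat list \<Rightarrow> 'a list \<Rightarrow> 'a" where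
  "hit p [] [] = d (last p)"
| "hit p [] (X # Xs) = bot"
| "hit p (a # w) [] = d (inf (p ! a) (hit p w []))"
| "hit p (a # w) (X # Xs) =
     sup (d (inf (p ! a) (hit p w (X # Xs)))) (d (inf (inf (p ! a) X) (hit p w Xs)))"

section \<open>Pushing an open forward through a list of opens\<close>

text \<open>\<open>reach\<close> is where the journey of \<open>y\<close> through the list ends;
  \<open>run\<close> records the journey itself. That \<open>reach\<close> preserves joins in
  \<open>y\<close> is what later allows the start to be cut into pieces.\<close>

definition reach :: "'a \<Rightarrow> 'a list \<Rightarrow> 'a" where
  "reach = foldl (\<lambda>y X. inf (u y) X)"

primrec run :: "'a list \<Rightarrow> 'a \<Rightarrow> 'a list" where
  "run [] y = []"
| "run (X # Xs) y = inf (u y) X # run Xs (inf (u y) X)"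

lemma reach_simps [simp]: "reach y [] = y" "reach y (X # Xs) = reach (inf (u y) X) Xs"
  by (simp_all add: reach_def)

lemma reach_mono: "y \<le> y' \<Longrightarrow> reach y Xs \<le> reach y' Xs"
proof (induction Xs arbitrary: y y')
  case (Cons X Xs)
  then have "inf (u y) X \<le> inf (u y') X" by (intro inf_mono u_mono order_refl)
  then show ?case using Cons.IH by simp
qed simp

lemma reach_u_mono: "y \<le> u y' \<Longrightarrow> Xs \<noteq> [] \<Longrightarrow> reach y Xs \<le> reach y' Xs"
  using u_mono[of y "u y'"] by (cases Xs) (auto intro!: reach_mono intro: le_infI1)

lemma reach_Sup: "reach (Sup S) Xs = Sup ((\<lambda>y. reach y Xs) ` S)"
  by (induction Xs arbitrary: S) (simp_all add: u_Sup Sup_inf image_image)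

lemma last_run: "Xs \<noteq> [] \<Longrightarrow> last (run Xs y) = reach y Xs"
proof (induction Xs arbitrary: y)
  case (Cons X Xs)
  then show ?case by (cases Xs) simp_all
qed simp

lemma run_nonempty [simp]: "run Xs y = [] \<longleftrightarrow> Xs = []"
  by (cases Xs) simp_all

text \<open>By Frobenius one may retain, along \<open>w\<close>, only what lies in the future of
  \<open>y\<close>. What arrives has met the members of \<open>Xs\<close> in order, hence lies in
  the open reached from \<open>y\<close>.\<close>

lemma hit_reach: "y \<le> hit p w Xs \<Longrightarrow> y \<le> itin p w (reach y (Xs @ [last p]))"
proof (induction p w Xs arbitrary: y rule: hit.induct)
  case (1 p)
  then show ?case using d_frobenius[of y "last p"] by (simp add: inf.absorb1 inf_commute)
next
  case (2 p X Xs)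
  then show ?case by (simp add: bot.extremum_unique)
next
  case (3 p a w)
  define z where "z = inf (inf (p ! a) (hit p w [])) (u y)"
  have "z \<le> hit p w []" by (simp add: z_def le_infI1)
  then have "z \<le> itin p w (reach z [last p])" using 3(1) by simp
  also have "\<dots> \<le> itin p w (reach y [last p])"
    by (intro itin_mono reach_u_mono) (simp_all add: z_def)
  finally have "z \<le> inf (p ! a) (itin p w (reach y [last p]))" by (simp add: z_def le_infI1)
  moreover have "y \<le> d z"
    using le_inf_u[of y "inf (p ! a) (hit p w [])"] 3(2)
    by (simp add: z_def le_imp_d inf_commute)
  ultimately show ?case by (simp only: itin.simps append_Nil) (rule le_d_trans)
next
  case (4 p a w X Xs)
  let ?r = "reach y ((X # Xs) @ [last p])"
  have 1: "inf y (d (inf (p ! a) (hit p w (X # Xs)))) \<le> d (inf (p ! a) (itin p w ?r))"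
  proof -
    define z where "z = inf (inf (p ! a) (hit p w (X # Xs))) (u y)"
    have "z \<le> hit p w (X # Xs)" by (simp add: z_def le_infI1)
    then have "z \<le> itin p w (reach z ((X # Xs) @ [last p]))" using 4(1) by blast
    also have "\<dots> \<le> itin p w ?r"
      by (intro itin_mono reach_u_mono) (simp_all add: z_def)
    finally have "z \<le> inf (p ! a) (itin p w ?r)" by (simp add: z_def le_infI1)
    then show ?thesis
      using d_frobenius[of y "inf (p ! a) (hit p w (X # Xs))"] unfolding z_def
      by (rule le_d_trans[rotated])
  qed
  have 2: "inf y (d (inf (inf (p ! a) X) (hit p w Xs))) \<le> d (inf (p ! a) (itin p w ?r))"
  proof -
    define z where "z = inf (inf (inf (p ! a) X) (hit p w Xs)) (u y)"
    have "z \<le> hit p w Xs" by (simp add: z_def le_infI1)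
    then have "z \<le> itin p w (reach z (Xs @ [last p]))" using 4(2) by blast
    also have "\<dots> \<le> itin p w (reach (inf (u y) X) (Xs @ [last p]))"
      by (intro itin_mono reach_mono) (simp add: z_def le_infI1 le_infI2)
    finally have "z \<le> inf (p ! a) (itin p w ?r)" by (simp add: z_def le_infI1)
    then show ?thesis
      using d_frobenius[of y "inf (inf (p ! a) X) (hit p w Xs)"] unfolding z_def
      by (rule le_d_trans[rotated])
  qed
  \<comment> \<open>Distributivity splits \<open>y\<close> according to whether \<open>X\<close> is
    met at the stop \<open>a\<close> or only later.\<close>
  have "y = sup (inf y (d (inf (p ! a) (hit p w (X # Xs)))))
    (inf y (d (inf (inf (p ! a) X) (hit p w Xs))))"
    using 4(3) inf_Sup_frame[of y "{d (inf (p ! a) (hit p w (X # Xs))),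
      d (inf (inf (p ! a) X) (hit p w Xs))}"] by (simp add: inf.absorb1)
  also have "\<dots> \<le> itin p (a # w) ?r" using 1 2 by simp
  finally show ?case .
qed

lemma run_d:
  "y \<le> d (hd Xs) \<Longrightarrow> successively (\<lambda>X Y. X \<le> d Y) Xs \<Longrightarrow> Y \<in> set (run Xs y) \<Longrightarrow> y \<le> d Y"
proof (induction Xs arbitrary: y)
  case (Cons X Xs)
  have y: "y \<le> d (inf (u y) X)" using le_inf_u Cons.prems by (simp add: le_imp_d)
  show ?case
  proof (cases "Y = inf (u y) X")
    case False
    then have "Y \<in> set (run Xs (inf (u y) X))" using Cons.prems by simp
    moreover from this have "inf (u y) X \<le> d (hd Xs)"
      using Cons.prems by (cases Xs) (auto intro: le_infI2)
    moreover have "successively (\<lambda>X Y. X \<le> d Y) Xs" using Cons.prems by (cases Xs) auto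
    ultimately have "inf (u y) X \<le> d Y" using Cons.IH by blast
    then have "d (inf (u y) X) \<le> d (d Y)" by (rule d_mono)
    then show ?thesis using y by (simp only: d_d)
  qed (use y in simp)
qed simp

lemma run_path:
  "y \<noteq> bot \<Longrightarrow> Xs \<noteq> [] \<Longrightarrow> y \<le> d (hd Xs) \<Longrightarrow> successively (\<lambda>X Y. X \<le> d Y) Xs \<Longrightarrow>
    is_path le (run Xs y) \<and> le y (hd (run Xs y))"
proof (induction Xs arbitrary: y)
  case (Cons X Xs)
  let ?y = "inf (u y) X"
  have y: "le y ?y" using le_inf_u Cons.prems by simp
  then have ne: "?y \<noteq> bot" using Cons.prems parallel_bot by metis
  show ?case
  proof (cases "Xs = []")
    case True
    then show ?thesis using y ne by (simp add: is_path_iff)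
  next
    case False
    then have "is_path le (run Xs ?y) \<and> le ?y (hd (run Xs ?y))"
      using Cons ne by (cases Xs) (auto intro: le_infI2)
    moreover have "is_path le [?y]" using ne by (simp add: is_path_iff)
    ultimately have "is_path le ([?y] @ run Xs ?y)" by (intro path_append) simp_all
    then show ?thesis using y by simp
  qed
qed simp

text \<open>
  The members of \<open>legs p v\<close> are the largest opens through which a path visiting \<open>p\<close> in the
  order \<open>v\<close> may run so that every starting open of it, however small, still yields a
  refinement of \<open>p\<close>. A stop \<open>i\<close> that is followed by a smaller one imposes no condition: it
  inherits an itinerary along \<open>p\<close> from the latter.
\<close>

primrec legs :: "'a list \<Rightarrow> nat list \<Rightarrow> 'a list" where
  "legs p [] = []"
| "legs p (i # v) =
     inf (inf (p ! i) (d (hd (legs p v @ [last p]))))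
       (if \<forall>k\<in>set v. i < k
        then Sup {hit p w (legs p v) |w. subseq [Suc i..<length p - 1] w} else top) # legs p v"

lemma hd_legs_le: "hd (legs p (i # v)) \<le> p ! i"
  by (simp add: le_infI1)

lemma legs_successively: "successively (\<lambda>X Y. X \<le> d Y) (legs p v @ [last p])"
proof (induction v)
  case (Cons i v)
  then show ?case by (cases "legs p v") (simp_all add: le_infI1)
qed simp

text \<open>At a stop with only larger ones after it, the supremum in \<open>legs\<close> supplies
  an itinerary by \<open>hit_reach\<close>. At any other stop some smaller \<open>k\<close> comes
  later in the run, and the itinerary from \<open>k\<close> contains the one needed. So a run
  through the legs, from any start, refines \<open>p\<close> at the stops of
  \<open>v\<close>.\<close>

lemma legs_itin:
  assumes "distinct v" "i \<in> set v"
  shows "\<exists>Y\<in>set (run (legs p v @ [last p]) y).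
    Y \<le> inf (p ! i) (itin p [Suc i..<length p - 1] (reach y (legs p v @ [last p])))"
  using assms
proof (induction v arbitrary: y i)
  case (Cons j v)
  let ?Z = "legs p v @ [last p]" and ?N = "length p - 1"
  define X where "X = hd (legs p (j # v))"
  define Y where "Y = inf (u y) X"
  have run: "run (legs p (j # v) @ [last p]) y = Y # run ?Z Y"
    and reach: "reach y (legs p (j # v) @ [last p]) = reach Y ?Z"
    by (simp_all add: Y_def X_def)
  show ?case
  proof (cases "i = j")
    case False
    then show ?thesis unfolding run reach using Cons by auto
  next
    case True
    have "Y \<le> p ! i" using hd_legs_le[of p j v] True by (simp add: Y_def X_def le_infI2)
    moreover have "Y \<le> itin p [Suc i..<?N] (reach Y ?Z)"
    proof (cases "\<forall>k\<in>set v. i < k")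
      case rec: True
      let ?H = "{hit p w (legs p v) |w. subseq [Suc i..<?N] w}"
      have "Y \<le> Sup ?H" unfolding Y_def X_def using rec True by (simp add: le_infI2)
      then have "Y = inf Y (Sup ?H)" by (simp only: inf.absorb1)
      also have "\<dots> = Sup (inf Y ` ?H)" by (rule inf_Sup_frame)
      finally have Y: "Y = Sup (inf Y ` ?H)" .
      have *: "inf Y h \<le> itin p [Suc i..<?N] (reach Y ?Z)" if h: "h \<in> ?H" for h
      proof -
        obtain w where w: "h = hit p w (legs p v)" "subseq [Suc i..<?N] w" using h by blast
        have "inf Y h \<le> itin p w (reach (inf Y h) ?Z)" using w by (intro hit_reach) simp
        also have "\<dots> \<le> itin p w (reach Y ?Z)" by (intro itin_mono reach_mono) simp
        also have "\<dots> \<le> itin p [Suc i..<?N] (reach Y ?Z)" using w by (intro itin_subseq)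
        finally show ?thesis .
      qed
      have "Sup (inf Y ` ?H) \<le> itin p [Suc i..<?N] (reach Y ?Z)" using * by (intro SUP_least)
      then show ?thesis using Y by (rule ord_eq_le_trans[rotated])
    next
      case False
      then obtain k where "k \<in> set v" "\<not> i < k" by blast
      moreover from this have "k \<noteq> i" using Cons.prems True by auto
      ultimately have k: "k \<in> set v" "k < i" by simp_all
      obtain Y' where Y': "Y' \<in> set (run ?Z Y)" "Y' \<le> itin p [Suc k..<?N] (reach Y ?Z)"
        using Cons.IH[of k Y] Cons.prems k by auto
      have "Y \<le> d (hd ?Z)" by (simp add: Y_def X_def le_infI1 le_infI2)
      then have "Y \<le> d Y'" using run_d legs_successively Y'(1) by blast
      then have "Y \<le> itin p [Suc k..<?N] (reach Y ?Z)" using Y'(2) by (rule le_d_itin)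
      also have "\<dots> \<le> itin p [Suc i..<?N] (reach Y ?Z)"
        using k by (intro itin_subseq subseq_upt) simp
      finally show ?thesis .
    qed
    ultimately show ?thesis unfolding run reach by simp
  qed
qed simp

text \<open>If the first stop \<open>a\<close> of the word is the head of \<open>v\<close>, then
  \<open>followed\<close> makes the rest of the word one of those in the supremum defining the leg
  at \<open>a\<close>. The second conclusion takes care of the factor of a leg that requires the
  next leg to be ahead.\<close>

lemma itin_le_hit:
  "followed (length p - 1) w \<Longrightarrow> subseq v w \<Longrightarrow>
    itin p w (last p) \<le> hit p w (legs p v) \<and> itin p w (last p) \<le> d (hd (legs p v @ [last p]))"
proof (induction w arbitrary: v)
  case (Cons a w)
  show ?case
  proof (cases "subseq v w")
    case True
    then have IH: "itin p w (last p) \<le> hit p w (legs p v)"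
      "itin p w (last p) \<le> d (hd (legs p v @ [last p]))"
      using Cons by auto
    have "itin p (a # w) (last p) \<le> d (inf (p ! a) (hit p w (legs p v)))"
      unfolding itin.simps using IH(1) by (intro d_mono inf_mono order_refl)
    also have "\<dots> \<le> hit p (a # w) (legs p v)" by (cases "legs p v") simp_all
    finally show ?thesis using IH(2) itin_Cons_le order_trans by blast
  next
    case False
    then obtain v' where v: "v = a # v'" and v': "subseq v' w"
      using Cons.prems(2) by (cases v) (auto split: if_splits)
    define X where "X = hd (legs p v)"
    have legs: "legs p v = X # legs p v'" by (simp add: X_def v)
    have IH: "itin p w (last p) \<le> hit p w (legs p v')"
      "itin p w (last p) \<le> d (hd (legs p v' @ [last p]))"
      using Cons v' by auto
    have "hit p w (legs p v') \<le> Sup {hit p w (legs p v') |w. subseq [Suc a..<length p - 1] w}"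
      using Cons.prems(1) by (intro Sup_upper) auto
    then have "inf (p ! a) (itin p w (last p)) \<le> X"
      using IH by (auto simp: X_def v intro: le_infI2 order_trans)
    then have *: "inf (p ! a) (itin p w (last p)) \<le> inf (inf (p ! a) X) (hit p w (legs p v'))"
      using IH(1) by (simp add: le_infI2)
    have "itin p (a # w) (last p) \<le> d (inf (inf (p ! a) X) (hit p w (legs p v')))"
      unfolding itin.simps using * by (rule d_mono)
    moreover from this have "itin p (a # w) (last p) \<le> d X"
      by (rule order_trans) (simp add: d_mono le_infI1)
    ultimately show ?thesis by (simp add: legs le_supI2)
  qed
qed (auto dest!: list_emb_Nil2)

text \<open>\<open>E i\<close> stands for the open with which some path visits stop \<open>i\<close>
  of \<open>p\<close>. A word is demanded only where the leg involves itineraries, and there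
  \<open>itin_le_hit\<close> applies.\<close>

lemma le_legs:
  assumes "sorted_wrt (\<lambda>i k. E i \<le> d (E k)) v"
    and "\<And>i. i \<in> set v \<Longrightarrow> E i \<le> p ! i \<and> E i \<le> d (last p)"
    and "\<And>i v'. suffix (i # v') v \<Longrightarrow> \<forall>k\<in>set v'. i < k \<Longrightarrow>
      \<exists>w. E i \<le> itin p w (last p) \<and> followed (length p - 1) w \<and>
        subseq [Suc i..<length p - 1] w \<and> subseq v' w"
  shows "list_all2 (\<lambda>i X. E i \<le> X) v (legs p v)"
  using assms
proof (induction v)
  case (Cons i v)
  have IH: "list_all2 (\<lambda>i X. E i \<le> X) v (legs p v)"
  proof (rule Cons.IH)
    fix i' v' assume "suffix (i' # v') v" "\<forall>k\<in>set v'. i' < k"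
    then show "\<exists>w. E i' \<le> itin p w (last p) \<and> followed (length p - 1) w \<and>
        subseq [Suc i'..<length p - 1] w \<and> subseq v' w"
      by (intro Cons.prems(3) suffix_ConsI)
  qed (use Cons.prems in auto)
  have "E i \<le> d (hd (legs p v @ [last p]))"
  proof (cases v)
    case Nil
    then show ?thesis using Cons.prems(2) by simp
  next
    case (Cons k v'')
    then have "E k \<le> hd (legs p v)" using IH by simp
    moreover have "E i \<le> d (E k)" using Cons.prems(1) Cons by simp
    ultimately show ?thesis using Cons by (auto intro: le_d_trans)
  qed
  moreover have "E i \<le> Sup {hit p w (legs p v) |w. subseq [Suc i..<length p - 1] w}"
    if rec: "\<forall>k\<in>set v. i < k"
  proof -
    obtain w where w: "E i \<le> itin p w (last p)" "followed (length p - 1) w"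
      "subseq [Suc i..<length p - 1] w" "subseq v w"
      using Cons.prems(3)[of i v] rec by auto
    then have "E i \<le> hit p w (legs p v)" using itin_le_hit order_trans by blast
    then show ?thesis using w(3) by (blast intro: Sup_upper2)
  qed
  ultimately show ?case using IH Cons.prems(2)[of i] by simp
qed simp

lemma le_reach:
  "list_all2 (\<lambda>i X. E i \<le> X) v Xs \<Longrightarrow> sorted_wrt (\<lambda>i k. E k \<le> u (E i)) v \<Longrightarrow>
    (\<And>i. i \<in> set v \<Longrightarrow> E i \<le> u y \<and> g \<le> u (E i)) \<Longrightarrow> g \<le> u y \<Longrightarrow> g \<le> t \<Longrightarrow>
    g \<le> reach y (Xs @ [t])"
proof (induction v Xs arbitrary: y rule: list_all2_induct)
  case (Cons i v X Xs)
  then have "E i \<le> inf (u y) X" by simp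
  then have "u (E i) \<le> u (inf (u y) X)" by (rule u_mono)
  then show ?case using Cons.prems by (auto intro!: Cons.IH intro: order_trans)
qed simp

text \<open>For \<open>m > 0\<close> the open \<open>q ! b\<close> occurs twice at the joint, as
  endpoint of the restricted piece and as head of the rest, so reflexivity joins the two.\<close>

lemma splice_path:
  assumes p: "is_path le p" and q: "is_path le q" "b < length q"
    and m: "m \<le> length p" "0 < m \<Longrightarrow> q ! b \<le> p ! (m - 1)"
  shows "is_path le (restrict_end le (take m p) (q ! b) @ drop b q)"
proof (cases "m = 0")
  case False
  have "p \<noteq> []" using p by (simp add: is_path_iff)
  then have last: "last (take m p) = p ! (m - 1)" using m False by (simp add: last_conv_nth)
  have "q ! b \<noteq> bot" using q by (simp add: is_path_def)
  then have "is_path le (restrict_end le (take m p) (q ! b))"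
    using p m False last by (intro restrict_end_path path_take) simp_all
  then show ?thesis using False \<open>p \<noteq> []\<close> q
    by (intro path_append path_drop) (simp_all add: last_restrict_end hd_drop_conv_nth le_refl)
qed (use q in \<open>simp add: path_drop\<close>)

lemma restrict_end_take_itin:
  assumes "i < m" "m \<le> length p" "E \<le> p ! (m - 1)" "E \<le> itin p w z"
  shows "restrict_end le (take m p) E ! i \<le> inf (p ! i) (itin p ([Suc i..<m] @ w) z)"
  using assms(1)
proof (induction "m - i" arbitrary: i)
  case (Suc n)
  let ?r = "restrict_end le (take m p) E"
  show ?case
  proof (cases "Suc i = m")
    case True
    then show ?thesis using assms by (auto simp: restrict_end_last)
  next
    case False
    then have i: "Suc i < m" using Suc by simp
    then have "?r ! Suc i \<le> inf (p ! Suc i) (itin p ([Suc (Suc i)..<m] @ w) z)" using Suc by simp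
    then have "d (?r ! Suc i) \<le> itin p (Suc i # [Suc (Suc i)..<m] @ w) z" by (simp add: d_mono)
    moreover have "Suc i # [Suc (Suc i)..<m] = [Suc i..<m]" using i by (simp add: upt_conv_Cons)
    ultimately show ?thesis using i assms(2)
      by (simp add: restrict_end_nth le_infI1 le_infI2 flip: append_Cons del: itin.simps)
  qed
qed simp

section \<open>Refinements through \<open>B\<close> when the order of visits can be followed\<close>

text \<open>Taking all suitable paths at once avoids choosing families; what remains is to show that
  their endpoints join to \<open>last p\<close>.\<close>

definition good :: "'a list \<Rightarrow> 'a \<Rightarrow> 'a list set" where
  "good p B = {s. is_path le s \<and> refines s (restrict_end le p (last s)) \<and> inhabits s B \<and>
     last s \<le> last p}"

text \<open>\<open>P\<close> follows \<open>p\<close> up to stop \<open>m - 1\<close>, changes to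
  \<open>q\<close> and ends at \<open>q ! a\<close> in \<open>A\<close>. The hypothesis on
  \<open>B\<close> refines \<open>P\<close> by paths through \<open>B\<close>, and each is prolonged
  by a run through the legs of the remaining stops, in the order \<open>v\<close> in which
  \<open>q\<close> visits them. The condition \<open>later\<close> makes the legs large enough for
  \<open>q\<close>, so the prolonged paths together reach all of \<open>last q\<close>.\<close>

lemma last_le_good:
  fixes q :: "'a list" and pos :: "nat \<Rightarrow> nat"
  assumes B: "B \<in> Cov_past le A" and p: "is_path le p" and q: "is_path le q" "last q \<le> last p"
    and pos: "\<And>i. i < length p - 1 \<Longrightarrow> pos i < length q \<and> q ! pos i \<le> p ! i \<and>
      q ! pos i \<le> itin p (W i) (last p)"
    and a: "a < length q" "q ! a \<le> A"
    and W: "nested (length p - 1) W"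
    and m: "m \<le> length p - 1" "0 < m \<Longrightarrow> pos (m - 1) \<le> a"
    and v: "set v = {m..<length p - 1}" "distinct v" "sorted_wrt (\<lambda>i k. pos i \<le> pos k) v"
      "\<And>i. i \<in> set v \<Longrightarrow> a \<le> pos i"
    and later: "\<And>i v'. suffix (i # v') v \<Longrightarrow> \<forall>k\<in>set v'. i < k \<Longrightarrow> subseq v' (W i)"
  shows "last q \<le> Sup (last ` good p B)"
proof -
  define N where "N = length p - 1"
  define Z where "Z = legs p v @ [last p]"
  \<comment> \<open>\<open>b\<close> is where \<open>q\<close> takes over from \<open>p\<close>. If
    \<open>m = 0\<close>, no initial piece of \<open>p\<close> is used and \<open>P\<close> is the
    single open \<open>q ! a\<close>.\<close>
  define b where "b = (if m = 0 then a else pos (m - 1))"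
  define P where "P = restrict_end le (take m p) (q ! b) @ drop b (take (Suc a) q)"
  have pne: "p \<noteq> []" and qne: "q \<noteq> []" using p q by (auto simp: is_path_iff)
  have lenp: "length p = Suc N" using pne by (cases p) (simp_all add: N_def)
  note pos = pos[folded N_def] and W = W[folded N_def] and m = m[folded N_def] and v = v[folded N_def]
  have b: "b \<le> a" using m by (simp add: b_def)
  have qb: "0 < m \<Longrightarrow> q ! b \<le> p ! (m - 1)" using pos[of "m - 1"] m by (auto simp: b_def)
  have q_d: "q ! i \<le> d (q ! j)" and q_u: "q ! j \<le> u (q ! i)" if "i \<le> j" "j < length q" for i j
    using path_nth_le[OF q(1) that] by (simp_all add: le_imp_d le_imp_u)
  have last_q: "last q = q ! (length q - 1)" using qne by (simp add: last_conv_nth)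
  have q_last: "q ! i \<le> d (last p)" if "i < length q" for i
    by (rule le_d_trans[OF q_d q(2)[unfolded last_q]]) (use that in auto)
  have q_last_u: "last q \<le> u (q ! i)" if "i < length q" for i
    using path_le_last[OF q(1), of "q ! i"] that by (simp add: le_imp_u)
  have P: "is_path le P"
  proof -
    have "is_path le (restrict_end le (take m p) (take (Suc a) q ! b) @ drop b (take (Suc a) q))"
      using b a qb m lenp by (intro splice_path p path_take q) simp_all
    then show ?thesis using b by (simp add: P_def)
  qed
  have lastP: "last P = q ! a" using a b by (simp add: P_def take_Suc_conv_app_nth)
  have lenP: "m < length P" using a b lenp m by (simp add: P_def)
  have P_le: "P ! i \<le> p ! i" if "i < m" for i
    using restrict_end_take_itin[of i m p "q ! b" "[]" "q ! b"] that qb m lenp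
    by (simp add: P_def nth_append d_ge)
  have E: "list_all2 (\<lambda>i X. q ! pos i \<le> X) v (legs p v)"
  proof (rule le_legs)
    show "sorted_wrt (\<lambda>i k. q ! pos i \<le> d (q ! pos k)) v"
      using v(3) by (rule sorted_wrt_mono_rel[rotated]) (use v(1) pos q_d in auto)
    show "q ! pos i \<le> p ! i \<and> q ! pos i \<le> d (last p)" if "i \<in> set v" for i
      using that v(1) pos q_last by simp
    fix i v' assume *: "suffix (i # v') v" "\<forall>k\<in>set v'. i < k"
    then have "i < N" using v(1) set_mono_suffix by fastforce
    then show "\<exists>w. q ! pos i \<le> itin p w (last p) \<and> followed (length p - 1) w \<and>
        subseq [Suc i..<length p - 1] w \<and> subseq v' w"
      using pos later[OF *] nested_followed[OF W] nested_upt[OF W] unfolding N_def by blast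
  qed
  have a_Z: "q ! a \<le> d (hd Z)"
  proof (cases v)
    case Nil
    then show ?thesis using q_last a by (simp add: Z_def)
  next
    case (Cons i v')
    then have "q ! pos i \<le> hd Z" using E by (auto simp: Z_def)
    moreover have "i \<in> {m..<N}" using Cons v(1) by auto
    then have "q ! a \<le> d (q ! pos i)" using v(1,4) pos by (intro q_d) auto
    ultimately show ?thesis by (rule le_d_trans[rotated])
  qed
  have last_le: "last q \<le> reach (q ! a) Z" unfolding Z_def
  proof (rule le_reach[OF E])
    show "sorted_wrt (\<lambda>i k. q ! pos k \<le> u (q ! pos i)) v"
      using v(3) by (rule sorted_wrt_mono_rel[rotated]) (use v(1) pos q_u in auto)
    show "q ! pos i \<le> u (q ! a) \<and> last q \<le> u (q ! pos i)" if "i \<in> set v" for i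
      using that v(1,4) pos q_u[of a "pos i"] q_last_u by auto
  qed (use q a q_last_u in simp_all)
  obtain Q where Q: "local_past_refinement le Q P" "\<forall>s\<in>Q. inhabits s B"
    using B P lastP a unfolding Cov_past_def lands_def by auto
  \<comment> \<open>The endpoints of \<open>Q\<close> join to \<open>q ! a\<close> and
    \<open>reach\<close> preserves joins, so treating each \<open>s\<close> separately loses nothing
    that \<open>q\<close> reaches.\<close>
  have reach_eq: "reach (q ! a) Z = Sup ((\<lambda>y. reach y Z) ` last ` Q)"
    using Q(1) lastP by (simp add: local_past_refinement_def flip: reach_Sup)
  have "reach (last s) Z \<le> Sup (last ` good p B)" if s: "s \<in> Q" for s
  proof -
    define y where "y = last s"
    define z where "z = reach y Z"
    define t where "t = s @ run Z y"
    have path_s: "is_path le s" and ref: "refines s (restrict_end le P y)" and "y \<le> last P"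
      using Q(1) s local_past_refinement_last_le by (auto simp: local_past_refinement_def y_def)
    have sne: "s \<noteq> []" using path_s by (simp add: is_path_iff)
    then have y: "y \<noteq> bot" using path_s last_in_set by (fastforce simp: y_def is_path_iff)
    have Zne: "Z \<noteq> []" by (simp add: Z_def)
    have y_Z: "y \<le> d (hd Z)" using \<open>y \<le> last P\<close> lastP a_Z by simp
    have run: "is_path le (run Z y)" "le y (hd (run Z y))"
      using run_path[OF y Zne y_Z] legs_successively by (simp_all add: Z_def)
    have path_t: "is_path le t" unfolding t_def using path_s run by (intro path_append) (simp_all add: y_def)
    have last_t: "last t = z" using Zne by (simp add: t_def z_def last_run)
    have y_d: "y \<le> d Y" if "Y \<in> set (run Z y)" for Y
      using run_d[OF y_Z _ that] legs_successively by (simp add: Z_def)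
    have visit: "\<exists>Y\<in>set (run Z y). Y \<le> inf (p ! i) (itin p [Suc i..<N] z)" if "m \<le> i" "i < N" for i
      using legs_itin[OF v(2), of i p y] v(1) that by (auto simp: Z_def z_def N_def)
    have y_m: "y \<le> itin p [m..<N] z"
    proof (cases "m = N")
      case True
      have "z \<in> set (run Z y)" using last_in_set[of "run Z y"] Zne by (simp add: last_run z_def)
      then show ?thesis using True y_d by simp
    next
      case False
      then obtain Y where Y: "Y \<in> set (run Z y)" "Y \<le> inf (p ! m) (itin p [Suc m..<N] z)"
        using visit[of m] m by auto
      then have "y \<le> d (inf (p ! m) (itin p [Suc m..<N] z))" using y_d le_d_trans by blast
      then show ?thesis using False m by (simp add: upt_conv_Cons)
    qed
    let ?R = "restrict_end le P y"
    have R: "is_path le ?R" using P \<open>y \<le> last P\<close> y by (rule restrict_end_path)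
    \<comment> \<open>From a stop before \<open>m\<close> one follows \<open>p\<close> to stop
      \<open>m - 1\<close>, then reaches \<open>y\<close>, and \<open>y_m\<close> leads on to
      \<open>z\<close>.\<close>
    have R_le: "?R ! i \<le> inf (p ! i) (itin p [Suc i..<N] z)" if "i < m" for i
      using that
    proof (induction "m - i" arbitrary: i)
      case (Suc n)
      have "?R ! i \<le> P ! i" using Suc lenP \<open>y \<le> last P\<close> by (intro restrict_end_le) simp_all
      then have "?R ! i \<le> p ! i" using P_le[of i] Suc by simp
      moreover have "?R ! i \<le> itin p [Suc i..<N] z"
      proof (cases "Suc i = m")
        case True
        have "le (?R ! i) (last ?R)" using R lenP True by (intro path_le_last) auto
        moreover have "last ?R = y" using P by (simp add: last_restrict_end is_path_iff)
        ultimately show ?thesis using y_m True by (auto intro: le_d_itin le_imp_d)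
      next
        case False
        then have i: "Suc i < m" using Suc by simp
        then have "?R ! Suc i \<le> inf (p ! Suc i) (itin p [Suc (Suc i)..<N] z)" using Suc by simp
        then have "d (?R ! Suc i) \<le> itin p [Suc i..<N] z"
          using i m by (simp add: upt_conv_Cons d_mono)
        moreover have "?R ! i \<le> d (?R ! Suc i)"
          using path_nth_le[OF R, of i "Suc i"] i lenP by (simp add: le_imp_d)
        ultimately show ?thesis by simp
      qed
      ultimately show ?case by simp
    qed simp
    have "refines t (restrict_end le p (last t))"
    proof (subst refines_itin_iff)
      show "\<forall>i<length p - 1. \<exists>k<length t. t ! k \<le> inf (p ! i) (itin p [Suc i..<length p - 1] (last t))"
      proof (intro allI impI)
        fix i assume "i < length p - 1"
        then have i: "i < N" by (simp add: N_def)
        have "\<exists>x\<in>set t. x \<le> inf (p ! i) (itin p [Suc i..<N] z)"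
        proof (cases "i < m")
          case True
          then obtain k where k: "k < length s" "s ! k \<le> ?R ! i"
            using ref lenP unfolding refines_def by (metis length_restrict_end less_trans)
          then have "s ! k \<in> set t" "s ! k \<le> inf (p ! i) (itin p [Suc i..<N] z)"
            using R_le[OF True] k by (auto simp: t_def)
          then show ?thesis by blast
        next
          case False
          then show ?thesis using visit[of i] i by (auto simp: t_def)
        qed
        then show "\<exists>k<length t. t ! k \<le> inf (p ! i) (itin p [Suc i..<length p - 1] (last t))"
          by (auto simp: in_set_conv_nth last_t N_def)
      qed
    qed (use sne pne in \<open>simp_all add: t_def\<close>)
    moreover have "inhabits t B"
      using Q(2) s unfolding inhabits_def t_def by (force simp: nth_append)
    moreover have "z \<le> last p" by (simp add: z_def Z_def reach_def)
    ultimately have "t \<in> good p B" using path_t last_t by (simp add: good_def)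
    then have "last t \<le> Sup (last ` good p B)" by (intro Sup_upper imageI)
    then show ?thesis by (simp add: last_t z_def y_def)
  qed
  then have "reach (q ! a) Z \<le> Sup (last ` good p B)"
    unfolding reach_eq image_image by (rule SUP_least)
  with last_le show ?thesis by (rule order_trans)
qed


lemma sorted_wrt_subseq:
  assumes "sorted_wrt P v" "subseq w v"
  shows "sorted_wrt P w"
  using assms(2,1) by (induction rule: list_emb.induct) (auto elim!: list_emb_set)

lemma key_le_imp:
  fixes pos :: "nat \<Rightarrow> nat"
  shows "pos i * N + i \<le> pos k * N + k \<Longrightarrow> k < N \<Longrightarrow> pos i \<le> pos k"
proof (rule ccontr)
  assume *: "pos i * N + i \<le> pos k * N + k" "k < N" "\<not> pos i \<le> pos k"
  then have "Suc (pos k) * N \<le> pos i * N" by (intro mult_right_mono) simp_all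
  then show False using * by simp
qed

text \<open>
  Every path \<open>q\<close> obtained from \<open>r\<close> through \<open>A\<close> either visits \<open>p\<close> in an order that the
  itineraries \<open>W\<close> can follow, or it visits some \<open>j\<close> before a smaller \<open>c\<close> in a way that yields
  longer itineraries for the path which follows \<open>p\<close> up to \<open>j\<close> and \<open>q\<close> from there on. The
  latter can happen only finitely often.
\<close>

lemma last_le_good_nested:
  assumes A: "A \<in> Cov_past le U" and B: "B \<in> Cov_past le A"
    and p: "is_path le p" "last p \<le> U"
  shows "nested (length p - 1) W \<Longrightarrow> is_path le r \<Longrightarrow> last r \<le> last p \<Longrightarrow>
    (\<And>i. i < length p - 1 \<Longrightarrow> \<exists>k < length r. r ! k \<le> p ! i \<and> r ! k \<le> itin p (W i) (last p)) \<Longrightarrow>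
    last r \<le> Sup (last ` good p B)"
proof (induction "potential_bound (length p - 1) - potential (length p - 1) W"
    arbitrary: W r rule: less_induct)
  case less
  define N where "N = length p - 1"
  note W = less.prems(1)[folded N_def] and r = less.prems(2,3)
  have lenp: "length p = Suc N" using p by (cases p) (simp_all add: N_def is_path_iff)
  obtain Q where Q: "local_past_refinement le Q r" "\<forall>q\<in>Q. inhabits q A"
    using A p r unfolding Cov_past_def lands_def by fastforce
  have "last q \<le> Sup (last ` good p B)" if q_Q: "q \<in> Q" for q
  proof -
    have q: "is_path le q" and ref: "refines q (restrict_end le r (last q))" and "last q \<le> last r"
      using Q(1) q_Q local_past_refinement_last_le by (auto simp: local_past_refinement_def)
    then have q_p: "last q \<le> last p" using r by simp
    have "\<exists>k < length q. q ! k \<le> p ! i \<and> q ! k \<le> itin p (W i) (last p)" if i: "i < N" for i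
    proof -
      obtain k where k: "k < length r" "r ! k \<le> p ! i" "r ! k \<le> itin p (W i) (last p)"
        using less.prems(4) i by (auto simp: N_def)
      then obtain k' where k': "k' < length q" "q ! k' \<le> restrict_end le r (last q) ! k"
        using ref unfolding refines_def by auto
      have "q ! k' \<le> r ! k"
        using k'(2) restrict_end_le[OF \<open>last q \<le> last r\<close> k(1)] by (rule order_trans)
      then have "q ! k' \<le> p ! i \<and> q ! k' \<le> itin p (W i) (last p)"
        using k(2,3) by (simp add: order_trans[of _ "r ! k"])
      then show ?thesis using k'(1) by blast
    qed
    then obtain pos where pos: "\<And>i. i < N \<Longrightarrow> pos i < length q \<and> q ! pos i \<le> p ! i \<and>
        q ! pos i \<le> itin p (W i) (last p)" by metis
    obtain a where a: "a < length q" "q ! a \<le> A" using Q(2) q_Q by (auto simp: inhabits_def)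
    \<comment> \<open>By minimality stop \<open>m - 1\<close>, if there is one, is visited no later
      than \<open>a\<close>, which permits the change from \<open>p\<close> to \<open>q\<close>
      there.\<close>
    define m where "m = (LEAST m. \<forall>i\<in>{m..<N}. a < pos i)"
    have m_pos: "\<forall>i\<in>{m..<N}. a < pos i" unfolding m_def by (rule LeastI[of _ N]) simp
    have m_le: "m \<le> N" unfolding m_def by (rule Least_le) simp
    have m_a: "pos (m - 1) \<le> a" if "0 < m"
    proof -
      have "\<not> (\<forall>i\<in>{m - 1..<N}. a < pos i)"
        unfolding m_def by (rule not_less_Least) (use that in \<open>simp add: m_def\<close>)
      then obtain i where i: "i \<in> {m - 1..<N}" "pos i \<le> a" by (auto simp: not_less)
      have "i = m - 1"
      proof (rule ccontr)
        assume "i \<noteq> m - 1"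
        then have "i \<in> {m..<N}" using i by auto
        then have "a < pos i" using m_pos by blast
        then show False using i by simp
      qed
      then show ?thesis using i by simp
    qed
    \<comment> \<open>Stops are ordered by position in \<open>q\<close>, ties being broken by the
      index, so that two stops visited at the same position never count as an inversion.\<close>
    define key where "key i = pos i * N + i" for i
    have key: "pos i \<le> pos k" if "key i \<le> key k" "k < N" for i k
      using key_le_imp that unfolding key_def by blast
    define v where "v = sort_key key [m..<N]"
    have v: "set v = {m..<N}" "distinct v" "sorted (map key v)" by (simp_all add: v_def)
    have sorted_v: "sorted_wrt (\<lambda>i k. key i \<le> key k) v" using v(3) by (simp add: sorted_map)
    show ?thesis
    proof (cases "\<forall>i v'. suffix (i # v') v \<longrightarrow> (\<forall>k\<in>set v'. i < k) \<longrightarrow> subseq v' (W i)")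
      case True
      have "sorted_wrt (\<lambda>i k. pos i \<le> pos k) v"
        using sorted_v by (rule sorted_wrt_mono_rel[rotated]) (use v key in auto)
      then show ?thesis
        using True B p q q_p pos a W m_le m_a v m_pos unfolding N_def
        by (intro last_le_good[of B A p q pos W a m v]) (auto simp: less_imp_le)
    next
      case False
      then obtain i v' where iv': "suffix (i # v') v" "\<forall>k\<in>set v'. i < k" "\<not> subseq v' (W i)"
        by blast
      then obtain l where v_eq: "v = l @ i # v'" by (auto simp: suffix_def)
      have set_v': "set v' \<subseteq> {Suc i..<N}" and i: "i < N" and dist: "distinct v'"
        using iv' v by (auto simp: v_eq Suc_le_eq)
      \<comment> \<open>By \<open>subseq_nested\<close>, the failure of \<open>W i\<close> to follow
        \<open>v'\<close> comes from an inversion \<open>b\<close>, \<open>c\<close> and a word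
        \<open>e # w\<close> missing at \<open>c\<close>.\<close>
      have "\<not> (\<forall>b c e w. subseq [b, c] v' \<longrightarrow> c < b \<longrightarrow> e \<in> {b, c} \<longrightarrow> w \<in> words N (W c) \<longrightarrow>
          e \<notin> set w \<longrightarrow> subseq (e # w) (W c))"
        using subseq_nested[OF W dist i set_v'] iv'(3) by blast
      then obtain b c e w where bc: "subseq [b, c] v'" "c < b" and e: "e \<in> {b, c}"
        and w: "w \<in> words N (W c)" "e \<notin> set w" and new: "\<not> subseq (e # w) (W c)" by blast
      have "b \<in> set v'" "c \<in> set v'" 
        using list_emb_set[OF bc(1), of b] list_emb_set[OF bc(1), of c] by auto
      then have bN: "b < N" and cN: "c < N" using set_v' by auto
      have "sorted_wrt (\<lambda>i k. key i \<le> key k) v'" using sorted_v by (simp add: v_eq sorted_wrt_append)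
      then have "sorted_wrt (\<lambda>i k. key i \<le> key k) [b, c]"
        by (rule sorted_wrt_subseq) (rule bc(1))
      then have "key b \<le> key c" by simp
      moreover have "key b \<noteq> key c"
      proof
        assume eq: "key b = key c"
        then have "pos b = pos c" using key[of b c] key[of c b] bN cN by simp
        then show False using eq bc(2) by (simp add: key_def)
      qed
      ultimately have key_bc: "key b < key c" by simp
      \<comment> \<open>The largest stop \<open>j\<close> preceding \<open>c\<close> satisfies
        \<open>b \<le> j\<close>, and the stops beyond \<open>j\<close> are visited no earlier than
        \<open>c\<close>, so they survive in the part of \<open>q\<close> from \<open>pos j\<close>
        on.\<close>
      define J where "J = {k. k < N \<and> key k < key c}"
      define j where "j = Max J"
      have "finite J" "b \<in> J" using bN key_bc by (simp_all add: J_def)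
      then have "j \<in> J" and b_j: "b \<le> j" by (auto simp: j_def intro: Max_in)
      then have j: "j < N" "key j < key c" by (simp_all add: J_def)
      have cj: "c < j" using bc b_j by simp
      have j_c: "pos j < pos c"
        using key[of j c] j cN cj by (cases "pos j = pos c") (auto simp: key_def)
      have after: "pos c \<le> pos k" if "j < k" "k < N" for k
      proof -
        have "k \<notin> J" using that \<open>finite J\<close> by (metis Max_ge j_def not_less)
        then show ?thesis using that key[of c k] by (simp add: J_def)
      qed
      define W' where "W' = graft W j c"
      define r' where "r' = restrict_end le (take (Suc j) p) (q ! pos j) @ drop (pos j) q"
      have nested': "nested N W'" unfolding W'_def by (rule nested_graft[OF W cj j(1)])
      \<comment> \<open>The grafted itinerary at \<open>c\<close> is
        \<open>[Suc c..<Suc j] @ c # W c\<close>: if \<open>e = c\<close>, this letter comes from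
        the return to \<open>c\<close>, and if \<open>e = b\<close>, from the stretch up to
        \<open>j\<close>.\<close>
      have "e # w \<in> words N (W' c)"
      proof -
        have "subseq (e # w) ([Suc c..<Suc j] @ c # W c)"
        proof (cases "e = c")
          case True
          then show ?thesis using w by (intro list_emb_append2) (simp add: words_def)
        next
          case False
          then have "subseq [e] [Suc c..<Suc j]"
            using e bc b_j by (simp add: subseq_singleton_left del: upt_Suc)
          moreover have "subseq w (c # W c)" using w by (auto simp: words_def intro: list_emb_Cons)
          ultimately show ?thesis
            using list_emb_append_mono[of "(=)" "[e]" "[Suc c..<Suc j]" w "c # W c"] by simp
        qed
        then show ?thesis using w e bN cN cj by (auto simp: words_def W'_def graft_def)
      qed
      moreover have "e # w \<notin> words N (W c)" using new by (simp add: words_def)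
      ultimately have pot: "potential N W < potential N W'"
        unfolding W'_def using potential_graft[OF W cj j(1)] by blast
      have path': "is_path le r'" unfolding r'_def
        using pos[of j] j lenp by (intro splice_path p q) simp_all
      have last': "last r' = last q" using pos[of j] j by (simp add: r'_def)
      have visit: "\<exists>k' < length r'. r' ! k' \<le> p ! k \<and> r' ! k' \<le> itin p (W' k) (last p)"
        if k: "k < N" for k
      proof (cases "k \<le> j")
        case True
        have "q ! pos j \<le> d (q ! pos c)"
          using path_nth_le[OF q, of "pos j" "pos c"] j_c pos[OF cN] by (simp add: le_imp_d)
        moreover have "q ! pos c \<le> inf (p ! c) (itin p (W c) (last p))" using pos[OF cN] by simp
        ultimately have "q ! pos j \<le> itin p (c # W c) (last p)"
          unfolding itin.simps by (rule le_d_trans)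
        then have "restrict_end le (take (Suc j) p) (q ! pos j) ! k \<le>
            inf (p ! k) (itin p ([Suc k..<Suc j] @ c # W c) (last p))"
          using True j lenp pos[of j] by (intro restrict_end_take_itin) simp_all
        then show ?thesis using True j lenp
          by (intro exI[of _ k]) (simp add: r'_def W'_def graft_def nth_append del: upt_Suc)
      next
        case False
        then have "pos j \<le> pos k" using after[of k] k j_c by simp
        then obtain n where n: "pos k = pos j + n" by (auto simp: le_iff_add)
        have "Suc j + n < length r'" "r' ! (Suc j + n) = q ! pos k"
          using n pos[OF k] j lenp by (auto simp: r'_def nth_append)
        then show ?thesis using False pos[OF k]
          by (intro exI[of _ "Suc j + n"]) (simp add: W'_def graft_def)
      qed
      have "last r' \<le> Sup (last ` good p B)"
      proof (rule less.hyps[OF _ nested'[unfolded N_def] path'])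
        show "last r' \<le> last p" using last' q_p by simp
        show "\<exists>k' < length r'. r' ! k' \<le> p ! k \<and> r' ! k' \<le> itin p (W' k) (last p)"
          if "k < length p - 1" for k
          using visit that by (simp add: N_def)
      qed (rule diff_less_mono2[OF pot[unfolded N_def]
            less_le_trans[OF pot[unfolded N_def] potential_le]])
      then show ?thesis using last' by simp
    qed
  qed
  moreover have "last r = Sup (last ` Q)" using Q(1) by (simp add: local_past_refinement_def)
  ultimately show ?case by (simp add: SUP_least)
qed

section \<open>Properties of past coverages\<close>

text \<open>The iteration starts with \<open>p\<close> itself and the itineraries that just follow
  \<open>p\<close>; these are available because \<open>p\<close> is its own restriction to
  \<open>last p\<close>.\<close>

lemma Cov_past_trans:
  assumes A: "A \<in> Cov_past le U" and B: "B \<in> Cov_past le A"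
  shows "B \<in> Cov_past le U"
proof -
  have "B \<le> d A" "A \<le> d U" using A B by (simp_all add: Cov_past_def)
  then have "B \<le> d U" using d_mono[of A "d U"] by simp
  moreover have "local_past_refinement le (good p B) p" if p: "is_path le p" "last p \<le> U" for p
  proof -
    have "\<exists>k<length p. p ! k \<le> p ! i \<and> p ! k \<le> itin p [Suc i..<length p - 1] (last p)"
      if "i < length p - 1" for i
      using that restrict_end_itin[of i p "last p"] restrict_end_last_self[OF p(1)]
      by (intro exI[of _ i]) (simp add: le_iff_inf)
    then have "last p \<le> Sup (last ` good p B)"
      using p by (intro last_le_good_nested[OF A B p nested_upto]) simp_all
    then have "Sup (last ` good p B) = last p"
      by (intro antisym) (auto simp: good_def intro: SUP_least)
    then show ?thesis by (simp add: local_past_refinement_def good_def)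
  qed
  moreover have "\<forall>q\<in>good p B. inhabits q B" for p by (simp add: good_def)
  ultimately show ?thesis unfolding Cov_past_def lands_def by blast
qed

text \<open>A path landing in \<open>U\<close> ends in \<open>A\<close> and is its own refinement.
  Both \<open>U\<close> and \<open>d U\<close> are possible choices of \<open>A\<close>.\<close>

lemma Cov_past_above:
  assumes "U \<le> A" "A \<le> d U"
  shows "A \<in> Cov_past le U"
proof -
  have "local_past_refinement le {p} p \<and> (\<forall>q\<in>{p}. inhabits q A)"
    if p: "is_path le p" "last p \<le> U" for p
  proof -
    have "refines p p" by (auto simp: refines_def)
    moreover have "inhabits p A" using p assms unfolding inhabits_def is_path_iff
      by (intro exI[of _ "length p - 1"]) (auto simp: last_conv_nth intro: order_trans)
    ultimately show ?thesis using p by (simp add: local_past_refinement_def restrict_end_last_self)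
  qed
  then show ?thesis using assms(2) unfolding Cov_past_def lands_def by blast
qed

text \<open>The refinement for \<open>A\<close> serves again: its paths end below \<open>W\<close>,
  so all their members lie in \<open>d W\<close>.\<close>

lemma Cov_past_inf:
  assumes "A \<in> Cov_past le U" "W \<le> U"
  shows "inf A (d W) \<in> Cov_past le W"
proof -
  have "\<exists>Q. local_past_refinement le Q p \<and> (\<forall>q\<in>Q. inhabits q (inf A (d W)))"
    if p: "is_path le p" "last p \<le> W" for p
  proof -
    obtain Q where Q: "local_past_refinement le Q p" "\<forall>q\<in>Q. inhabits q A"
      using assms p unfolding Cov_past_def lands_def by fastforce
    have "inhabits q (inf A (d W))" if q: "q \<in> Q" for q
    proof -
      obtain n where n: "n < length q" "q ! n \<le> A" using Q(2) q by (auto simp: inhabits_def)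
      have "is_path le q" "last q \<le> last p"
        using Q(1) q local_past_refinement_last_le by (auto simp: local_past_refinement_def)
      then have "q ! n \<le> d (last q)" "last q \<le> W"
        using p path_le_last[of q "q ! n"] n by (auto intro: le_imp_d)
      then have "q ! n \<le> d W" by (rule le_d_trans)
      then show ?thesis using n by (auto simp: inhabits_def)
    qed
    then show ?thesis using Q(1) by blast
  qed
  then show ?thesis unfolding Cov_past_def lands_def by simp
qed

text \<open>Covering the one-member path \<open>[U]\<close> puts all endpoints, hence
  \<open>U\<close>, into the future of \<open>A\<close>; with \<open>A \<le> d U\<close>,
  \<open>le_iff\<close> applies. The case \<open>U = bot\<close> is separate since
  \<open>[bot]\<close> is no path.\<close>

lemma Cov_past_le:
  assumes "A \<in> Cov_past le U"
  shows "le A U"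
proof (cases "U = bot")
  case False
  then have "is_path le [U]" by (simp add: is_path_iff)
  then obtain Q where Q: "local_past_refinement le Q [U]" "\<forall>q\<in>Q. inhabits q A"
    using assms unfolding Cov_past_def lands_def by fastforce
  have "last q \<le> u A" if q: "q \<in> Q" for q
  proof -
    obtain n where n: "n < length q" "q ! n \<le> A" using Q(2) q by (auto simp: inhabits_def)
    have "is_path le q" using Q(1) q by (simp add: local_past_refinement_def)
    then have "last q \<le> u (q ! n)" using path_le_last[of q "q ! n"] n by (auto intro: le_imp_u)
    also have "\<dots> \<le> u A" using n by (intro u_mono)
    finally show ?thesis .
  qed
  moreover have "U = Sup (last ` Q)" using Q(1) by (simp add: local_past_refinement_def)
  ultimately have "U \<le> u A" by (simp add: SUP_least)
  then show ?thesis using assms by (simp add: le_iff Cov_past_def)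
qed (use assms in \<open>simp add: le_iff Cov_past_def\<close>)

lemma Cov_past_bot: "Cov_past le bot = {bot}"
proof
  show "Cov_past le bot \<subseteq> {bot}" by (auto simp: Cov_past_def bot.extremum_unique)
qed (simp add: Cov_past_above)

end

subsection \<open>Time reversal\<close>

lemma up_cone_conversep [simp]: "up_cone le\<inverse>\<inverse> = down_cone le"
  and down_cone_conversep [simp]: "down_cone le\<inverse>\<inverse> = up_cone le"
  by (simp_all add: up_cone_def down_cone_def fun_eq_iff)

lemma cone_ordered_locale_conversep:
  assumes "parallel_ordered_locale le" "cones_preserve_joins le"
  shows "cone_ordered_locale le\<inverse>\<inverse>"
proof -
  interpret parallel_ordered_locale le by fact
  show ?thesis
  proof
    fix R :: "('a \<times> 'a) set" assume "\<And>U V. (U, V) \<in> R \<Longrightarrow> le\<inverse>\<inverse> U V"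
    then have "le (Sup (fst ` (prod.swap ` R))) (Sup (snd ` (prod.swap ` R)))"
      by (intro le_Sup) auto
    then show "le\<inverse>\<inverse> (Sup (fst ` R)) (Sup (snd ` R))" by (simp add: image_image)
  next
    show "cones_preserve_joins le\<inverse>\<inverse>" using assms(2) by (simp add: cones_preserve_joins_def)
  next
    fix U V V' :: 'a assume "U \<le> V" "le\<inverse>\<inverse> V V'"
    then show "\<exists>U'. le\<inverse>\<inverse> U U' \<and> U' \<le> V'" using parallel_past[of V' V U] by auto
  next
    fix V V' U' :: 'a assume "le\<inverse>\<inverse> V V'" "U' \<le> V'"
    then show "\<exists>U. U \<le> V \<and> le\<inverse>\<inverse> U U'" using parallel_future[of U' V' V] by auto
  qed (use le_refl le_trans parallel_bot in auto)
qed

lemma restrict_end_rev: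
  assumes "p \<noteq> []"
  shows "restrict_end le\<inverse>\<inverse> (rev p) V = rev (restrict_start le p V)"
proof (rule nth_equalityI)
  fix i assume "i < length (restrict_end le\<inverse>\<inverse> (rev p) V)"
  then have "i < length p" by simp
  then show "restrict_end le\<inverse>\<inverse> (rev p) V ! i = rev (restrict_start le p V) ! i"
  proof (induction "length p - i" arbitrary: i)
    case (Suc n)
    let ?l = "restrict_end le\<inverse>\<inverse> (rev p) V" and ?r = "restrict_start le p V"
    show ?case
    proof (cases "Suc i = length p")
      case True
      have ne: "?l \<noteq> []" "?r \<noteq> []" using assms
        by (metis length_0_conv length_restrict_end length_rev, metis length_0_conv length_restrict_start)
      then have "?l ! i = last ?l" "rev ?r ! i = hd ?r"
        using True by (simp_all add: last_conv_nth rev_nth hd_conv_nth flip: True)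
      then show ?thesis using assms by (simp add: last_restrict_end hd_restrict_start)
    next
      case False
      define k where "k = length p - Suc (Suc i)"
      have k: "Suc k < length p" "length p - Suc i = Suc k" using False Suc.prems by (auto simp: k_def)
      have "?l ! Suc i = rev ?r ! Suc i" using Suc False by simp
      also have "\<dots> = ?r ! k" using False Suc.prems by (simp add: rev_nth k_def)
      finally have "?l ! i = inf (p ! Suc k) (up_cone le (?r ! k))"
        using False Suc.prems k by (simp add: restrict_end_nth rev_nth)
      also have "\<dots> = ?r ! Suc k" using k by (simp add: restrict_start_nth)
      finally show ?thesis using Suc.prems k by (simp add: rev_nth)
    qed
  qed simp
qed simp

lemma is_path_rev: "is_path le\<inverse>\<inverse> (rev p) \<longleftrightarrow> is_path le p"
proof -
  have "is_path le\<inverse>\<inverse> (rev p)" if p: "is_path le p" for le :: "'a::frame \<Rightarrow> 'a \<Rightarrow> bool" and p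
    unfolding is_path_def
  proof (intro conjI allI impI)
    fix n assume n: "Suc n < length (rev p)"
    then have "Suc (length p - Suc (Suc n)) = length p - Suc n" by simp
    moreover have "le (p ! (length p - Suc (Suc n))) (p ! Suc (length p - Suc (Suc n)))"
      using p n unfolding is_path_def by auto
    ultimately show "le\<inverse>\<inverse> (rev p ! n) (rev p ! Suc n)" using n by (simp add: rev_nth)
  qed (use p in \<open>auto simp: is_path_def rev_nth\<close>)
  from this[of le p] this[of "le\<inverse>\<inverse>" "rev p"] show ?thesis by auto
qed

lemma bex_rev: "(\<exists>m < length (rev q). rev q ! m \<le> x) \<longleftrightarrow> (\<exists>m < length q. q ! m \<le> x)"
  by (metis (no_types, lifting) in_set_conv_nth set_rev)

lemma inhabits_rev: "inhabits (rev q) A \<longleftrightarrow> inhabits q A"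
  unfolding inhabits_def by (rule bex_rev)

lemma refines_rev: "refines (rev q) (rev p) \<longleftrightarrow> refines q p"
proof -
  have "refines q p \<longleftrightarrow> (\<forall>x\<in>set p. \<exists>m < length q. q ! m \<le> x)" for q p :: "'a list"
    by (auto simp: refines_def all_set_conv_all_nth)
  then show ?thesis by (simp only: bex_rev set_rev)
qed

lemma local_past_refinement_rev:
  assumes "p \<noteq> []"
  shows "local_past_refinement le\<inverse>\<inverse> (rev ` Q) (rev p) \<longleftrightarrow> local_future_refinement le Q p"
proof -
  have "last (rev q) = hd q" if "is_path le q" for q
    using that by (simp add: is_path_def last_rev)
  then show ?thesis
    unfolding local_past_refinement_def local_future_refinement_def
    using assms by (auto simp: is_path_rev last_rev restrict_end_rev refines_rev image_image
        cong: image_cong_simp)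
qed

text \<open>Reversal is a bijection on paths and on families of paths, so both quantifiers may range
  over reversed lists.\<close>

lemma Cov_past_conversep: "Cov_past le\<inverse>\<inverse> U = Cov_future le U"
proof -
  have *: "(\<exists>Q. local_past_refinement le\<inverse>\<inverse> Q (rev p) \<and> (\<forall>q\<in>Q. inhabits q A)) \<longleftrightarrow>
      (\<exists>Q. local_future_refinement le Q p \<and> (\<forall>q\<in>Q. inhabits q A))"
    if "is_path le p" for p A
  proof -
    have ex_rev: "(\<exists>Q. P Q) \<longleftrightarrow> (\<exists>Q. P (rev ` Q))" for P :: "'a list set \<Rightarrow> bool"
    proof
      assume "\<exists>Q. P Q"
      then obtain Q where "P Q" ..
      then have "P (rev ` rev ` Q)" by (simp add: image_image)
      then show "\<exists>Q. P (rev ` Q)" ..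
    qed blast
    show ?thesis
      by (subst ex_rev[of "\<lambda>Q. local_past_refinement le\<inverse>\<inverse> Q (rev p) \<and> (\<forall>q\<in>Q. inhabits q A)"])
        (use that in \<open>simp add: local_past_refinement_rev inhabits_rev is_path_def\<close>)
  qed
  have all_rev: "(\<forall>p. P p) \<longleftrightarrow> (\<forall>p. P (rev p))" for P :: "'a list \<Rightarrow> bool"
    by (metis rev_rev_ident)
  have "(is_path le\<inverse>\<inverse> (rev p) \<and> lands (rev p) U \<longrightarrow>
        (\<exists>Q. local_past_refinement le\<inverse>\<inverse> Q (rev p) \<and> (\<forall>q\<in>Q. inhabits q A))) \<longleftrightarrow>
      (is_path le p \<and> hd p \<le> U \<longrightarrow>
        (\<exists>Q. local_future_refinement le Q p \<and> (\<forall>q\<in>Q. inhabits q A)))" for p A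
  proof (cases "is_path le p")
    case True
    then have "lands (rev p) U \<longleftrightarrow> hd p \<le> U" by (simp add: lands_def last_rev is_path_def)
    then show ?thesis using True by (simp only: is_path_rev *)
  qed (simp add: is_path_rev)
  then show ?thesis
    unfolding Cov_past_def Cov_future_def down_cone_conversep
    by (subst all_rev) (simp only:)
qed

theorem lemma8p11:
  fixes le :: "'a::frame \<Rightarrow> 'a \<Rightarrow> bool"
  assumes "parallel_ordered_locale le"
    and "cones_preserve_joins le"
  shows "\<forall>U W A B.
    (U \<in> Cov_past le U \<and> U \<in> Cov_future le U) \<and>
    (down_cone le U \<in> Cov_past le U \<and> up_cone le U \<in> Cov_future le U) \<and>
    (B \<in> Cov_past le A \<and> A \<in> Cov_past le U \<longrightarrow> B \<in> Cov_past le U) \<and>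
    (B \<in> Cov_future le A \<and> A \<in> Cov_future le U \<longrightarrow> B \<in> Cov_future le U) \<and>
    (A \<in> Cov_past le U \<and> W \<le> U \<longrightarrow> inf A (down_cone le W) \<in> Cov_past le W) \<and>
    (B \<in> Cov_future le U \<and> W \<le> U \<longrightarrow> inf B (up_cone le W) \<in> Cov_future le W) \<and>
    (A \<in> Cov_past le U \<longrightarrow> le A U) \<and>
    (B \<in> Cov_future le U \<longrightarrow> le U B) \<and>
    Cov_past le bot = {bot} \<and> Cov_future le bot = {bot}"
proof -
  interpret past: cone_ordered_locale le
    using assms by (simp add: cone_ordered_locale_def cone_ordered_locale_axioms_def)
  \<comment> \<open>The past results for the converse preorder are the future results for the given
    one.\<close>
  interpret future: cone_ordered_locale "le\<inverse>\<inverse>"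
    using assms by (rule cone_ordered_locale_conversep)
  note reverse = Cov_past_conversep down_cone_conversep conversep_iff
  show ?thesis
  proof (intro allI conjI impI; (elim conjE)?)
    fix U W A B :: 'a
    show "U \<in> Cov_past le U" by (rule past.Cov_past_above[OF order_refl past.d_ge])
    show "U \<in> Cov_future le U"
      by (rule future.Cov_past_above[OF order_refl future.d_ge, unfolded reverse])
    show "down_cone le U \<in> Cov_past le U" by (rule past.Cov_past_above[OF past.d_ge order_refl])
    show "up_cone le U \<in> Cov_future le U"
      by (rule future.Cov_past_above[OF future.d_ge order_refl, unfolded reverse])
    show "B \<in> Cov_past le U" if "B \<in> Cov_past le A" "A \<in> Cov_past le U"
      using that(2,1) by (rule past.Cov_past_trans)
    show "B \<in> Cov_future le U" if "B \<in> Cov_future le A" "A \<in> Cov_future le U"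
      using that(2,1) by (rule future.Cov_past_trans[unfolded reverse])
    show "inf A (down_cone le W) \<in> Cov_past le W" if "A \<in> Cov_past le U" "W \<le> U"
      using that by (rule past.Cov_past_inf)
    show "inf B (up_cone le W) \<in> Cov_future le W" if "B \<in> Cov_future le U" "W \<le> U"
      using that by (rule future.Cov_past_inf[unfolded reverse])
    show "le A U" if "A \<in> Cov_past le U" using that by (rule past.Cov_past_le)
    show "le U B" if "B \<in> Cov_future le U" using that by (rule future.Cov_past_le[unfolded reverse])
    show "Cov_past le bot = {bot}" by (rule past.Cov_past_bot)
    show "Cov_future le bot = {bot}" by (rule future.Cov_past_bot[unfolded reverse])
  qed
qed

end
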